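(* Let $m\ge 2$ and $n\ge 3$ be integers. Let the list $(\rho,\lambda_2,\lambda_3,\ldots,\lambda_m)$ of complex numbers be realisable, where $\rho$ is the Perron eigenvalue, $\lambda_2$ is real and $\rho\neq\lambda_2$. Let $\delta$ be a real number with \[ (n-2)\max\{0,\lambda_2\}\leq\delta\leq\frac{1}{2}(n-2)(\rho+\lambda_2) \] and let $\mu:=(\mu_1,\mu_2,\ldots,\mu_n)$ be a list of complex numbers, closed under complex conjugation, with $\mu_1\geq 0$ (in particular $\mu_1$ is real) and $\mathrm{Re}\,\mu_i\leq\delta/(n-2)$ for all $i=2,3,\ldots,n$. Assume also that \[ \sum_{i=1}^n\mu_i=\rho+\lambda_2+\delta \] and \[ \sum_{i=1}^n\mu_i^2=\rho^2+\lambda_2^2+\frac{\delta^2}{n-2}. \] Then the list \[ (\mu_1,\mu_2,\ldots,\mu_n,\lambda_3,\lambda_4,\ldots,\lambda_m) \] is realisable.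
   Context: A list of complex numbers $(\lambda_1,\ldots,\lambda_k)$ is called realisable if there is a $k\times k$ entrywise nonnegative real matrix whose spectrum (eigenvalues counted with algebraic multiplicity) is this list. The order of entries is immaterial, except that when the first entry $\rho$ of a realisable list is said to be the Perron eigenvalue, this means that $\rho$ is the spectral radius of a realising matrix, i.e. $\rho$ is a nonnegative real number equal to the maximum of the moduli of the entries of the list. A list is closed under complex conjugation if conjugating all its entries gives the same list up to reordering (as a multiset). *)

theory Defs
  imports
    "Jordan_Normal_Form.Spectral_Radius"
    "HOL-Library.Nonpos_Ints"
begin

text \<open>
  \<open>proots p\<close> is the multiset of roots of \<open>p\<close> counted with their order, so
  \<open>proots (char_poly B)\<close> is the spectrum of the complex matrix \<open>B\<close> with
  algebraic multiplicities.
\<close>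

definition realises :: "real mat \<Rightarrow> complex list \<Rightarrow> bool" where
  "realises A xs \<longleftrightarrow>
     A \<in> carrier_mat (length xs) (length xs) \<and>
     (\<forall>i<length xs. \<forall>j<length xs. A $$ (i, j) \<ge> 0) \<and>
     proots (char_poly (map_mat complex_of_real A)) = mset xs"

definition realisable :: "complex list \<Rightarrow> bool" where
  "realisable xs \<longleftrightarrow> (\<exists>A. realises A xs)"

definition perron_eigenvalue :: "real \<Rightarrow> complex list \<Rightarrow> bool" where
  "perron_eigenvalue r xs \<longleftrightarrow>
     (\<exists>A. realises A xs \<and> r = spectral_radius (map_mat complex_of_real A))"

definition conjugation_closed :: "complex list \<Rightarrow> bool" where
  "conjugation_closed xs \<longleftrightarrow> mset (map cnj xs) = mset xs"

end

theory Submission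
  imports Defs "HOL-Analysis.Function_Topology"
begin

text \<open>
  Put \<open>d = \<delta> / (n - 2)\<close>. The power sum conditions say that the polynomial with roots
  \<open>\<mu>\<^sub>i - d\<close> has the same three leading coefficients as
  \<open>X ^ (n - 2) * (X - (\<rho> - d)) * (X - (\<lambda>\<^sub>2 - d))\<close>. All its other coefficients are nonpositive: this follows from
  inequalities between the coefficients of the product over \<open>i \<ge> 2\<close>, whose roots lie in the left half plane.
  Hence for every nonnegative \<open>2 \<times> 2\<close> matrix \<open>C\<close> with eigenvalues \<open>\<rho>, \<lambda>\<^sub>2\<close> and
  a nonzero off-diagonal entry there is a nonnegative matrix with spectrum \<open>\<mu>\<close> that contains \<open>C\<close> as a principal block.

  On the other side, the first list has a realisation \<open>A\<close> with constant row sums \<open>\<rho>\<close>. The extreme rays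
  of the cone of nonnegative vectors in the plane spanned by the all-ones vector and an eigenvector
  of \<open>\<lambda>\<^sub>2\<close> form a nonnegative \<open>m \<times> 2\<close> matrix \<open>X\<close> two of whose rows are the unit vectors, and
  \<open>A X = X C\<close> with \<open>C\<close> as above. Bordering \<open>A\<close> by the new rows and columns, multiplied
  by \<open>X\<close>, replaces the eigenvalues \<open>\<rho>, \<lambda>\<^sub>2\<close> of \<open>A\<close> by \<open>\<mu>\<close>.
\<close>

section \<open>Coefficients of polynomials with roots in the left half plane\<close>

text \<open>Extension by zero to negative indices makes multiplication by a factor a plain shift.
  With truncated subtraction on naturals, \<open>i - 1\<close> at zero would repeat the constant
  coefficient.\<close>

definition icoeff :: "'a::zero poly \<Rightarrow> int \<Rightarrow> 'a" where
  "icoeff p i = (if i < 0 then 0 else coeff p (nat i))"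

lemma icoeff_of_nat [simp]: "icoeff p (int j) = coeff p j"
  by (simp add: icoeff_def)

lemma icoeff_1: "icoeff 1 i = (if i = 0 then 1 else 0)"
  by (auto simp: icoeff_def one_pCons coeff_pCons split: nat.splits)

lemma icoeff_add: "icoeff (p + q) i = icoeff p i + icoeff q i"
  for p :: "'a::comm_ring_1 poly"
  by (simp add: icoeff_def)

lemma icoeff_smult: "icoeff (Polynomial.smult a p) i = a * icoeff p i"
  for p :: "'a::comm_ring_1 poly"
  by (simp add: icoeff_def)

lemma icoeff_pCons_0: "icoeff (pCons 0 p) i = icoeff p (i - 1)"
  by (cases "nat i") (auto simp: icoeff_def nat_diff_distrib)

lemma icoeff_linear_mult:
  "icoeff ([:c, b:] * p) i = b * icoeff p (i - 1) + c * icoeff p i"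
  for p :: "'a::comm_ring_1 poly"
  by (simp add: mult_pCons_left icoeff_add icoeff_smult icoeff_pCons_0)

lemma icoeff_quadratic_mult:
  "icoeff ([:c, b, a:] * p) i = a * icoeff p (i - 2) + b * icoeff p (i - 1) + c * icoeff p i"
  for p :: "'a::comm_ring_1 poly"
  by (simp add: mult_pCons_left icoeff_add icoeff_smult icoeff_pCons_0 algebra_simps)

text \<open>These are \<open>2 \<times> 2\<close> minors of the Hurwitz matrix of a polynomial with coefficients \<open>c\<close>. Allowing all
  gaps \<open>j - i\<close>, and integer indices, makes the family closed under multiplication by quadratic
  polynomials without a case distinction for vanishing coefficients.\<close>

definition hurwitz_seq :: "(int \<Rightarrow> real) \<Rightarrow> bool" where
  "hurwitz_seq c \<longleftrightarrow> (\<forall>i. 0 \<le> c i) \<and>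
     (\<forall>i j. i < j \<longrightarrow> odd (j - i) \<longrightarrow> c (i - 1) * c (j + 1) \<le> c i * c j) \<and>
     (\<forall>i j. i \<le> j \<longrightarrow> even (j - i) \<longrightarrow> c (i - 2) * c (j + 2) \<le> c i * c j)"

text \<open>Each minor of \<open>h\<close> is a quadratic form in \<open>a\<close>,
  \<open>b\<close>, \<open>c\<close>. Its six coefficients are sums of minors of \<open>g\<close>,
  up to products that cancel, hence nonnegative.\<close>

lemma hurwitz_seq_quadratic_mult:
  assumes g: "hurwitz_seq g" and nn: "0 \<le> a" "0 \<le> b" "0 \<le> c"
    and h: "\<And>i. h i = a * g (i - 2) + b * g (i - 1) + c * g i"
  shows "hurwitz_seq h"
proof -
  have pos: "0 \<le> g i" for i
    using g by (simp add: hurwitz_seq_def)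
  have odd_ineq: "g (i - 1) * g (j + 1) \<le> g i * g j" if "i < j" "odd (j - i)" for i j
    using g that by (simp add: hurwitz_seq_def)
  have even_ineq: "g (i - 2) * g (j + 2) \<le> g i * g j" if "i \<le> j" "even (j - i)" for i j
    using g that by (simp add: hurwitz_seq_def)
  have expand: "0 \<le> h i * h j - h (i - s) * h (j + s)"
    if "0 \<le> g (i-2) * g (j-2) - g (i-s-2) * g (j+s-2)"
       "0 \<le> g (i-1) * g (j-1) - g (i-s-1) * g (j+s-1)"
       "0 \<le> g i * g j - g (i-s) * g (j+s)"
       "0 \<le> g (i-2) * g (j-1) + g (i-1) * g (j-2) - g (i-s-2) * g (j+s-1) - g (i-s-1) * g (j+s-2)"
       "0 \<le> g (i-2) * g j + g i * g (j-2) - g (i-s-2) * g (j+s) - g (i-s) * g (j+s-2)"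
       "0 \<le> g (i-1) * g j + g i * g (j-1) - g (i-s-1) * g (j+s) - g (i-s) * g (j+s-1)"
    for i j s :: int
  proof -
    have "0 \<le> a^2 * (g (i-2) * g (j-2) - g (i-s-2) * g (j+s-2))
       + b^2 * (g (i-1) * g (j-1) - g (i-s-1) * g (j+s-1))
       + c^2 * (g i * g j - g (i-s) * g (j+s))
       + a * b * (g (i-2) * g (j-1) + g (i-1) * g (j-2) - g (i-s-2) * g (j+s-1) - g (i-s-1) * g (j+s-2))
       + a * c * (g (i-2) * g j + g i * g (j-2) - g (i-s-2) * g (j+s) - g (i-s) * g (j+s-2))
       + b * c * (g (i-1) * g j + g i * g (j-1) - g (i-s-1) * g (j+s) - g (i-s) * g (j+s-1))"
      by (intro add_nonneg_nonneg mult_nonneg_nonneg that nn zero_le_power)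
    also have "\<dots> = h i * h j - h (i - s) * h (j + s)"
      unfolding h by (simp add: algebra_simps power2_eq_square)
    finally show ?thesis .
  qed
  have "h (i - 1) * h (j + 1) \<le> h i * h j" if ij: "i < j" "odd (j - i)" for i j
  proof -
    have "0 \<le> h i * h j - h (i - 1) * h (j + 1)"
    proof (rule expand)
      show "0 \<le> g (i-2) * g (j-2) - g (i-1-2) * g (j+1-2)"
        using odd_ineq[of "i-2" "j-2"] ij by simp
      show "0 \<le> g (i-1) * g (j-1) - g (i-1-1) * g (j+1-1)"
        using odd_ineq[of "i-1" "j-1"] ij by simp
      show "0 \<le> g i * g j - g (i-1) * g (j+1)"
        using odd_ineq[of "i" "j"] ij by simp
      show "0 \<le> g (i-2) * g (j-1) + g (i-1) * g (j-2) - g (i-1-2) * g (j+1-1) - g (i-1-1) * g (j+1-2)"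
        using even_ineq[of "i-1" "j-2"] ij by (simp add: add.commute)
      show "0 \<le> g (i-1) * g j + g i * g (j-1) - g (i-1-1) * g (j+1) - g (i-1) * g (j+1-1)"
        using even_ineq[of "i" "j-1"] ij by (simp add: add.commute)
      have 1: "g (i-3) * g (j+1) \<le> g (i-2) * g j"
        using odd_ineq[of "i-2" "j"] ij by simp
      \<comment> \<open>At gap one this is not among the minors of the family, but there both sides
        are the same product.\<close>
      have 2: "g (i-1) * g (j-1) \<le> g i * g (j-2)"
      proof (cases "j = i + 1")
        case False
        with ij have "i < j - 2" by presburger
        with odd_ineq[of i "j-2"] ij show ?thesis by simp
      qed (simp add: mult.commute)
      show "0 \<le> g (i-2) * g j + g i * g (j-2) - g (i-1-2) * g (j+1) - g (i-1) * g (j+1-2)"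
        using 1 2 by simp
    qed
    then show ?thesis by simp
  qed
  moreover have "h (i - 2) * h (j + 2) \<le> h i * h j" if ij: "i \<le> j" "even (j - i)" for i j
  proof -
    \<comment> \<open>The four products form an increasing chain by inequalities of odd gap. The two
      smallest are compared with the two largest.\<close>
    have cross: "g (i'-3) * g (j'+2) + g (i'-2) * g (j'+1) \<le> g (i'-1) * g j' + g i' * g (j'-1)"
      if "i' \<le> j'" "even (j' - i')" for i' j'
    proof -
      have "g (i'-2) * g (j'+1) \<le> g (i'-1) * g j'" "g (i'-3) * g (j'+2) \<le> g (i'-2) * g (j'+1)"
        using odd_ineq[of "i'-1" j'] odd_ineq[of "i'-2" "j'+1"] that by (simp_all add: add.commute)
      moreover have "g (i'-1) * g j' \<le> g i' * g (j'-1)"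
      proof (cases "i' = j'")
        case False
        with that have "i' < j' - 1" by presburger
        with odd_ineq[of i' "j'-1"] that show ?thesis by simp
      qed (simp add: mult.commute)
      ultimately show ?thesis by linarith
    qed
    have "0 \<le> h i * h j - h (i - 2) * h (j + 2)"
    proof (rule expand)
      show "0 \<le> g (i-2) * g (j-2) - g (i-2-2) * g (j+2-2)"
        using even_ineq[of "i-2" "j-2"] ij by simp
      show "0 \<le> g (i-1) * g (j-1) - g (i-2-1) * g (j+2-1)"
        using even_ineq[of "i-1" "j-1"] ij by simp
      show "0 \<le> g i * g j - g (i-2) * g (j+2)"
        using even_ineq[of "i" "j"] ij by simp
      show "0 \<le> g (i-2) * g (j-1) + g (i-1) * g (j-2) - g (i-2-2) * g (j+2-1) - g (i-2-1) * g (j+2-2)"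
        using cross[of "i-1" "j-1"] ij by (simp add: add.commute)
      show "0 \<le> g (i-1) * g j + g i * g (j-1) - g (i-2-1) * g (j+2) - g (i-2) * g (j+2-1)"
        using cross[of i j] ij by (simp add: add.commute)
      have "g (i-4) * g (j+2) \<le> g (i-2) * g j"
        using even_ineq[of "i-2" j] ij by simp
      also have "\<dots> \<le> g i * g (j-2)"
      proof (cases "i = j")
        case False
        with ij have "i \<le> j - 2" by presburger
        with even_ineq[of i "j-2"] ij show ?thesis by simp
      qed (simp add: mult.commute)
      finally show "0 \<le> g (i-2) * g j + g i * g (j-2) - g (i-2-2) * g (j+2) - g (i-2) * g (j+2-2)"
        by simp
    qed
    then show ?thesis by simp
  qed
  moreover have "0 \<le> h i" for i
    unfolding h by (intro add_nonneg_nonneg mult_nonneg_nonneg pos nn)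
  ultimately show ?thesis by (simp add: hurwitz_seq_def)
qed

lemma hurwitz_seq_1: "hurwitz_seq (icoeff 1)"
  by (auto simp: hurwitz_seq_def icoeff_1)

interpretation of_real_poly_hom: map_poly_idom_hom complex_of_real ..

text \<open>Induction on the number of roots, splitting off a real root x or a conjugate pair. The
  factors X - x and X^2 - 2 Re z X + |z|^2 have nonnegative coefficients because the real parts are
  nonpositive, so they preserve the minor inequalities.\<close>

lemma cnj_closed_prod_real:
  assumes "image_mset cnj Z = Z" and "\<And>z. z \<in># Z \<Longrightarrow> Re z \<le> 0"
  shows "\<exists>g. map_poly complex_of_real g = (\<Prod>z\<in>#Z. [:- z, 1:]) \<and> hurwitz_seq (icoeff g)"
  using assms
proof (induction "size Z" arbitrary: Z rule: less_induct)
  case less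
  show ?case
  proof (cases "Z = {#}")
    case True
    then show ?thesis using hurwitz_seq_1 by (intro exI[of _ 1]) simp
  next
    case False
    then obtain z where z: "z \<in># Z" by blast
    then obtain Y where Y: "Z = add_mset z Y" by (meson multi_member_split)
    show ?thesis
    proof (cases "cnj z = z")
      case True
      then obtain x where x: "z = complex_of_real x"
        by (metis Reals_cnj_iff Reals_cases)
      have "image_mset cnj Y = Y" using less.prems(1) True unfolding Y by simp
      then obtain g where g: "map_poly complex_of_real g = (\<Prod>z\<in>#Y. [:- z, 1:])" "hurwitz_seq (icoeff g)"
        using less.hyps[of Y] less.prems Y by auto
      \<comment> \<open>A linear factor is treated as a quadratic one with leading coefficient
        zero.\<close>
      have "hurwitz_seq (icoeff ([:- x, 1:] * g))"
        by (rule hurwitz_seq_quadratic_mult[OF g(2), of 0 1 "- x"])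
          (use less.prems(2)[OF z] x in \<open>simp_all add: icoeff_linear_mult del: mult_pCons_left\<close>)
      moreover have "map_poly complex_of_real ([:- x, 1:] * g) = (\<Prod>z\<in>#Z. [:- z, 1:])"
        by (simp add: of_real_poly_hom.hom_mult g(1) Y x map_poly_pCons del: mult_pCons_left)
      ultimately show ?thesis by blast
    next
      case False
      have "cnj z \<in># Z" using less.prems(1) z by (metis image_eqI set_image_mset)
      with False have "cnj z \<in># Y" by (auto simp: Y)
      then obtain X where X: "Y = add_mset (cnj z) X" by (meson multi_member_split)
      have "image_mset cnj X = X" using less.prems(1) unfolding Y X by simp
      then obtain g where g: "map_poly complex_of_real g = (\<Prod>z\<in>#X. [:- z, 1:])" "hurwitz_seq (icoeff g)"
        using less.hyps[of X] less.prems Y X by auto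
      let ?q = "[:(Re z)\<^sup>2 + (Im z)\<^sup>2, - 2 * Re z, 1:]"
      have "hurwitz_seq (icoeff (?q * g))"
        by (rule hurwitz_seq_quadratic_mult[OF g(2), of 1 "- 2 * Re z" "(Re z)\<^sup>2 + (Im z)\<^sup>2"])
          (use less.prems(2)[OF z] in \<open>simp_all add: icoeff_quadratic_mult del: mult_pCons_left\<close>)
      moreover have "map_poly complex_of_real ?q = [:- z, 1:] * [:- cnj z, 1:]"
        by (simp add: map_poly_pCons complex_eq_iff power2_eq_square)
      then have "map_poly complex_of_real (?q * g) = (\<Prod>z\<in>#Z. [:- z, 1:])"
        by (simp only: of_real_poly_hom.hom_mult g(1) Y X image_mset_add_mset prod_mset.add_mset mult.assoc)
      ultimately show ?thesis by blast
    qed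
  qed
qed

text \<open>If \<open>c\<close> holds the coefficients of a monic g of degree \<open>N\<close>, then
  \<open>c (j - 1) - \<mu> * c j\<close> is a coefficient of (X - \<mu>) g. Nonpositivity of the two
  coefficients below the leading one thus spreads to all lower ones: the parity of
  \<open>N - 1 - j\<close> decides which of the two is compared with index \<open>j\<close>.\<close>

lemma hurwitz_seq_ratio_bound:
  assumes g: "hurwitz_seq c" and top: "c N = 1" 
    and \<mu>: "c (N - 1) \<le> \<mu>" "c (N - 2) \<le> \<mu> * c (N - 1)" and j: "j \<le> N"
  shows "c (j - 1) \<le> \<mu> * c j"
proof -
  have pos: "0 \<le> c i" for i
    using g by (simp add: hurwitz_seq_def)
  have odd_ineq: "c (i - 1) * c (j + 1) \<le> c i * c j" if "i < j" "odd (j - i)" for i j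
    using g that by (simp add: hurwitz_seq_def)
  have even_ineq: "c (i - 2) * c (j + 2) \<le> c i * c j" if "i \<le> j" "even (j - i)" for i j
    using g that by (simp add: hurwitz_seq_def)
  consider "j = N" | "j = N - 1" | "j < N - 1" "odd (N - 1 - j)" | "j < N - 1" "even (N - 1 - j)"
    using j by force
  then show ?thesis
  proof cases
    case 3
    have "c (j - 1) * c N \<le> c j * c (N - 1)"
      using odd_ineq[of j "N - 1"] 3 by simp
    also have "\<dots> \<le> c j * \<mu>" by (intro mult_left_mono \<mu> pos)
    finally show ?thesis by (simp add: top mult.commute)
  next
    case 4
    then have lt: "j \<le> N - 3" by presburger
    show ?thesis
    proof (cases "c (N - 1) = 0")
      case False
      have "c (j - 1) * c (N - 1) \<le> c j * c (N - 2)"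
        using odd_ineq[of j "N - 2"] 4 lt by auto
      also have "\<dots> \<le> c j * (\<mu> * c (N - 1))" by (intro mult_left_mono \<mu> pos)
      finally have "c (N - 1) * c (j - 1) \<le> c (N - 1) * (\<mu> * c j)" by (simp add: mult_ac)
      with False pos[of "N - 1"] show ?thesis by simp
    next
      \<comment> \<open>Division by \<open>c (N - 1)\<close> is impossible here. But then
        \<open>c (N - 2)\<close> vanishes too, and an even-gap minor against \<open>c N = 1\<close>
        bounds \<open>c (j - 1)\<close> by zero.\<close>
      case True
      with \<mu> pos[of "N - 2"] have 0: "c (N - 2) = 0" by simp
      have "c (j - 1) * c N \<le> c (j + 1) * c (N - 2)"
        using even_ineq[of "j + 1" "N - 2"] 4 lt by auto
      with top 0 have "c (j - 1) \<le> 0" by simp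
      moreover have "0 \<le> \<mu> * c j" using True \<mu> pos by simp
      ultimately show ?thesis by linarith
    qed
  qed (use \<mu> top in auto)
qed

text \<open>Vieta's formulas, with the second elementary symmetric function expressed by power sums
  and doubled to avoid division in the ring.\<close>

lemma icoeff_prod_linear:
  fixes Z :: "'a::comm_ring_1 multiset"
  defines "p \<equiv> (\<Prod>z\<in>#Z. [:- z, 1:])" and "n \<equiv> int (size Z)"
  shows "i > n \<Longrightarrow> icoeff p i = 0" and "icoeff p n = 1" and "icoeff p (n - 1) = - (\<Sum>z\<in>#Z. z)"
    and "2 * icoeff p (n - 2) = (\<Sum>z\<in>#Z. z)\<^sup>2 - (\<Sum>z\<in>#Z. z\<^sup>2)"
proof -
  have "(\<forall>i>n. icoeff p i = 0) \<and> icoeff p n = 1 \<and> icoeff p (n - 1) = - (\<Sum>z\<in>#Z. z) \<and>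
      2 * icoeff p (n - 2) = (\<Sum>z\<in>#Z. z)\<^sup>2 - (\<Sum>z\<in>#Z. z\<^sup>2)"
    unfolding p_def n_def
  proof (induction Z)
    case (add x Z)
    let ?p = "\<Prod>z\<in>#Z. [:- z, 1:]" and ?n = "int (size Z)"
    have *: "icoeff (\<Prod>z\<in>#add_mset x Z. [:- z, 1:]) i = icoeff ?p (i - 1) - x * icoeff ?p i" for i
      by (simp add: icoeff_linear_mult del: mult_pCons_left)
    have "2 * (icoeff ?p (?n - 2) - x * icoeff ?p (?n - 1)) =
        (\<Sum>z\<in>#add_mset x Z. z)\<^sup>2 - (\<Sum>z\<in>#add_mset x Z. z\<^sup>2)"
      using add by (simp add: algebra_simps power2_eq_square)
    then show ?case using add unfolding * by simp
  qed (auto simp: icoeff_1)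
  then show "i > n \<Longrightarrow> icoeff p i = 0" and "icoeff p n = 1" and "icoeff p (n - 1) = - (\<Sum>z\<in>#Z. z)"
    and "2 * icoeff p (n - 2) = (\<Sum>z\<in>#Z. z)\<^sup>2 - (\<Sum>z\<in>#Z. z\<^sup>2)"
    by auto
qed

section \<open>Nonnegative matrices of constant row sums\<close>

lemma compact_cube: "compact {x :: nat \<Rightarrow> real. (\<forall>i<n. 0 \<le> x i \<and> x i \<le> 1) \<and> (\<forall>i\<ge>n. x i = 0)}"
proof -
  \<comment> \<open>Tychonoff's theorem: the coordinates from \<open>n\<close> on are confined to
    the point 0, so every factor is compact.\<close>
  have "compactin (product_topology (\<lambda>_. euclidean) UNIV)
      (PiE UNIV (\<lambda>i. if i < n then {0..1::real} else {0}))"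
    by (subst compactin_PiE) auto
  then have "compact (PiE UNIV (\<lambda>i. if i < n then {0..1::real} else {0}))"
    by (simp add: euclidean_product_topology)
  also have "PiE UNIV (\<lambda>i. if i < n then {0..1::real} else {0}) =
      {x. (\<forall>i<n. 0 \<le> x i \<and> x i \<le> 1) \<and> (\<forall>i\<ge>n. x i = 0)}"
    by (auto simp: PiE_iff not_less split: if_splits) (metis not_less)+
  finally show ?thesis .
qed

text \<open>Maximise t over pairs (t, x) with t x \<le> A x and x nonnegative of sum 1. Working with
  pairs gives a compact set with a continuous objective, whereas the minimum of the quotients (A
  x)_i / x_i need not be continuous in x.\<close>

lemma collatz_wielandt_max:
  fixes a :: "nat \<Rightarrow> nat \<Rightarrow> real"
  assumes n: "0 < n" and a: "\<And>i j. i < n \<Longrightarrow> j < n \<Longrightarrow> 0 \<le> a i j"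
  obtains r x where "0 \<le> r" "\<And>i. i < n \<Longrightarrow> 0 \<le> x i" "\<exists>i<n. 0 < x i"
    "\<And>i. i < n \<Longrightarrow> r * x i \<le> (\<Sum>j<n. a i j * x j)"
    "\<And>t y. (\<And>i. i < n \<Longrightarrow> 0 \<le> y i) \<Longrightarrow> \<exists>i<n. 0 < y i \<Longrightarrow>
       (\<And>i. i < n \<Longrightarrow> t * y i \<le> (\<Sum>j<n. a i j * y j)) \<Longrightarrow> t \<le> r"
proof -
  define K where "K = {x :: nat \<Rightarrow> real. (\<forall>i<n. 0 \<le> x i \<and> x i \<le> 1) \<and> (\<forall>i\<ge>n. x i = 0)}"
  \<comment> \<open>Adding all rows of t x \<le> A x, with entries of x at most 1 and of sum 1,
    gives t \<le> \<open>R\<close>.\<close>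
  define R where "R = (\<Sum>i<n. \<Sum>j<n. a i j)"
  define H where "H = {p :: real \<times> (nat \<Rightarrow> real). (\<Sum>i<n. snd p i) = 1} \<inter>
      (\<Inter>i\<in>{..<n}. {p. fst p * snd p i \<le> (\<Sum>j<n. a i j * snd p j)})"
  have cont: "continuous_on UNIV (\<lambda>p :: real \<times> (nat \<Rightarrow> real). snd p i)" for i
    by (rule continuous_on_compose2[OF continuous_on_product_coordinates continuous_on_snd]) (auto intro: continuous_intros)
  have "closed H"
    unfolding H_def
    by (intro closed_Int closed_INT ballI closed_Collect_eq closed_Collect_le continuous_intros cont)
  moreover have "compact ({0..R} \<times> K)"
    unfolding K_def by (intro compact_Times compact_cube) auto
  ultimately have cpt: "compact ({0..R} \<times> K \<inter> H)" (is "compact ?G")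
    by blast
  \<comment> \<open>Every competitor can be scaled to sum 1, and a negative \<open>t\<close> may be
    raised to 0 since the right-hand sides are nonnegative. So a maximum over the compact set bounds
    all competitors.\<close>
  have normalise: "\<exists>x. (max 0 t, x) \<in> ?G"
    if y: "\<And>i. i < n \<Longrightarrow> 0 \<le> y i" "\<exists>i<n. 0 < y i"
      "\<And>i. i < n \<Longrightarrow> t * y i \<le> (\<Sum>j<n. a i j * y j)" for t y
  proof -
    define s where "s = (\<Sum>i<n. y i)"
    from y have s: "0 < s"
      unfolding s_def by (metis sum_pos2 finite_lessThan lessThan_iff)
    define x where "x i = (if i < n then y i / s else 0)" for i
    have sum1: "(\<Sum>i<n. x i) = 1"
      using s by (simp add: x_def sum_divide_distrib[symmetric] s_def[symmetric])
    have x0: "0 \<le> x i" for i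
      using y(1) s by (simp add: x_def)
    have x1: "x i \<le> 1" if "i < n" for i
      using member_le_sum[of i "{..<n}" x] x0 sum1 that by simp
    have ineq: "max 0 t * x i \<le> (\<Sum>j<n. a i j * x j)" if i: "i < n" for i
    proof -
      have "t * x i \<le> (\<Sum>j<n. a i j * x j)"
      proof -
        have "t * x i = t * y i / s" using i by (simp add: x_def)
        also have "\<dots> \<le> (\<Sum>j<n. a i j * y j) / s"
          using y(3)[OF i] s by (simp add: divide_right_mono)
        also have "\<dots> = (\<Sum>j<n. a i j * x j)"
          by (simp add: x_def sum_divide_distrib)
        finally show ?thesis .
      qed
      moreover have "0 \<le> (\<Sum>j<n. a i j * x j)"
        by (intro sum_nonneg mult_nonneg_nonneg x0 a i) auto
      ultimately show ?thesis by (simp add: max_def)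
    qed
    have "max 0 t = (\<Sum>i<n. max 0 t * x i)"
      by (simp add: sum_distrib_left[symmetric] sum1)
    also have "\<dots> \<le> (\<Sum>i<n. \<Sum>j<n. a i j * x j)"
      by (intro sum_mono ineq) auto
    also have "\<dots> \<le> R"
      unfolding R_def by (intro sum_mono mult_left_le x1 a) auto
    finally have "max 0 t \<le> R" .
    moreover have "x \<in> K"
      using x0 x1 by (simp add: K_def) (simp add: x_def)
    ultimately have "(max 0 t, x) \<in> ?G"
      using ineq sum1 by (auto simp: H_def)
    then show ?thesis by blast
  qed
  have "\<exists>x. (max 0 0, x) \<in> ?G"
    by (rule normalise[of "\<lambda>_. 1"]) (use n a in \<open>auto intro!: sum_nonneg\<close>)
  then have "?G \<noteq> {}" by blast
  then have "\<exists>p\<in>?G. \<forall>q\<in>?G. fst q \<le> fst p"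
    by (intro continuous_attains_sup[OF cpt]) (auto intro: continuous_intros)
  then obtain p where p: "p \<in> ?G" "\<And>q. q \<in> ?G \<Longrightarrow> fst q \<le> fst p"
    by blast
  show ?thesis
  proof (rule that[of "fst p" "snd p"])
    have "(\<Sum>i<n. snd p i) = 1" and nn: "\<forall>i<n. 0 \<le> snd p i"
      using p(1) by (auto simp: H_def K_def)
    show "\<exists>i<n. 0 < snd p i"
    proof (rule ccontr)
      assume "\<not> ?thesis"
      then have "(\<Sum>i<n. snd p i) \<le> 0" by (intro sum_nonpos) (metis lessThan_iff not_less)
      with \<open>(\<Sum>i<n. snd p i) = 1\<close> show False by simp
    qed
    show "t \<le> fst p" if "\<And>i. i < n \<Longrightarrow> 0 \<le> y i" "\<exists>i<n. 0 < y i"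
      "\<And>i. i < n \<Longrightarrow> t * y i \<le> (\<Sum>j<n. a i j * y j)" for t y
    proof -
      have "\<exists>x. (max 0 t, x) \<in> ?G" by (rule normalise) (use that in auto)
      then obtain x where "(max 0 t, x) \<in> ?G" by blast
      from p(2)[OF this] show ?thesis by simp
    qed
  qed (use p(1) in \<open>auto simp: H_def K_def\<close>)
qed

text \<open>Among the maximisers take one with as many strict inequalities as possible. Slightly
  increasing an entry whose row is strict makes strict every row that sees this entry, so no
  equality row has a nonzero entry in a strict column.\<close>

lemma positive_eigenvector_or_reducible:
  fixes a :: "nat \<Rightarrow> nat \<Rightarrow> real"
  assumes n: "0 < n" and a: "\<And>i j. i < n \<Longrightarrow> j < n \<Longrightarrow> 0 \<le> a i j"
  shows "(\<exists>r x. 0 \<le> r \<and> (\<forall>i<n. 0 < x i) \<and> (\<forall>i<n. (\<Sum>j<n. a i j * x j) = r * x i)) \<or>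
    (\<exists>S\<subseteq>{..<n}. S \<noteq> {} \<and> S \<noteq> {..<n} \<and> (\<forall>i\<in>S. \<forall>j\<in>{..<n} - S. a i j = 0))"
proof -
  obtain r x0 where r: "0 \<le> r" and x0: "\<And>i. i < n \<Longrightarrow> 0 \<le> x0 i" "\<exists>i<n. 0 < x0 i"
    "\<And>i. i < n \<Longrightarrow> r * x0 i \<le> (\<Sum>j<n. a i j * x0 j)"
    and max: "\<And>t y. (\<And>i. i < n \<Longrightarrow> 0 \<le> y i) \<Longrightarrow> \<exists>i<n. 0 < y i \<Longrightarrow>
       (\<And>i. i < n \<Longrightarrow> t * y i \<le> (\<Sum>j<n. a i j * y j)) \<Longrightarrow> t \<le> r"
    using collatz_wielandt_max[of n a] n a by blast
  define feasible where "feasible x \<longleftrightarrow> (\<forall>i<n. 0 \<le> x i) \<and> (\<exists>i<n. 0 < x i) \<and>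
      (\<forall>i<n. r * x i \<le> (\<Sum>j<n. a i j * x j))" for x :: "nat \<Rightarrow> real"
  define Z where "Z x = {i\<in>{..<n}. r * x i < (\<Sum>j<n. a i j * x j)}" for x :: "nat \<Rightarrow> real"
  have "card (Z x) \<le> n" for x
    using card_mono[of "{..<n}" "Z x"] by (auto simp: Z_def)
  then have bounded: "\<forall>x. feasible x \<longrightarrow> card (Z x) < Suc n"
    by (simp add: less_Suc_eq_le)
  have "feasible x0" using x0 by (simp add: feasible_def)
  from ex_has_greatest_nat[where P = feasible and f = "\<lambda>x. card (Z x)", OF this bounded]
  obtain x where x: "feasible x" and most: "\<And>y. feasible y \<Longrightarrow> card (Z y) \<le> card (Z x)"
    by blast
  have nn: "0 \<le> x i" if "i < n" for i
    using x that by (simp add: feasible_def)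
  have le: "r * x i \<le> (\<Sum>j<n. a i j * x j)" if "i < n" for i
    using x that by (simp add: feasible_def)
  have ZD: "Z x \<subseteq> {..<n}" by (auto simp: Z_def)
  consider "Z x = {}" | "Z x = {..<n}" | "Z x \<noteq> {}" "Z x \<noteq> {..<n}" by blast
  then show ?thesis
  proof cases
    case 1
    then have eq: "(\<Sum>j<n. a i j * x j) = r * x i" if "i < n" for i
      using le[OF that] that by (force simp: Z_def)
    show ?thesis
    proof (cases "\<forall>i<n. 0 < x i")
      case True
      then show ?thesis using eq r by blast
    next
      case False
      \<comment> \<open>No row is strict, so \<open>x\<close> is an eigenvector. In a row where
        \<open>x\<close> vanishes all terms of the sum vanish, hence so do the entries in columns
        where \<open>x\<close> is positive.\<close>
      define S where "S = {i\<in>{..<n}. x i = 0}"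
      have "S \<noteq> {}" using False nn by (force simp: S_def)
      moreover have "\<exists>i<n. i \<notin> S" using x by (force simp: S_def feasible_def)
      then have "S \<noteq> {..<n}" by blast
      moreover have "a i j = 0" if "i \<in> S" "j \<in> {..<n} - S" for i j
      proof -
        have "(\<Sum>j<n. a i j * x j) = 0" using eq that by (simp add: S_def)
        then have "a i j * x j = 0"
          using that a nn by (subst (asm) sum_nonneg_eq_0_iff) (auto simp: S_def)
        with that show ?thesis by (simp add: S_def)
      qed
      ultimately show ?thesis by (intro disjI2 exI[of _ S]) (auto simp: S_def)
    qed
  next
    case 2
    \<comment> \<open>All rows are strict, so \<open>r\<close> can be increased by the least gap,
      against maximality. The summand 1 keeps the denominator positive where
      \<open>x i = 0\<close>.\<close>
    define gap where "gap i = ((\<Sum>j<n. a i j * x j) - r * x i) / (x i + 1)" for i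
    have gap: "0 < gap i" if "i < n" for i
      using 2 nn that by (force simp: gap_def Z_def intro!: divide_pos_pos)
    define \<epsilon> where "\<epsilon> = Min (gap ` {..<n})"
    have "gap ` {..<n} \<noteq> {}" using n by auto
    then have \<epsilon>: "0 < \<epsilon>" "\<And>i. i < n \<Longrightarrow> \<epsilon> \<le> gap i"
      using gap by (auto simp: \<epsilon>_def Min_gr_iff)
    have "r + \<epsilon> \<le> r"
    proof (rule max[of x])
      fix i assume i: "i < n"
      have "\<epsilon> * x i \<le> gap i * (x i + 1)"
        using \<epsilon> i nn[OF i] gap[OF i] by (intro mult_mono) auto
      also have "\<dots> = (\<Sum>j<n. a i j * x j) - r * x i"
        using nn[OF i] by (simp add: gap_def)
      finally show "(r + \<epsilon>) * x i \<le> (\<Sum>j<n. a i j * x j)"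
        by (simp add: algebra_simps)
    qed (use x in \<open>auto simp: feasible_def\<close>)
    with \<epsilon> show ?thesis by simp
  next
    case 3
    have "a i0 j0 = 0" if i0: "i0 \<in> {..<n} - Z x" and j0: "j0 \<in> Z x" for i0 j0
    proof (rule ccontr)
      assume "a i0 j0 \<noteq> 0"
      then have pos: "0 < a i0 j0" using a[of i0 j0] i0 j0 by (force simp: Z_def)
      have j0n: "j0 < n" using j0 by (simp add: Z_def)
      \<comment> \<open>Row \<open>j0\<close> has slack \<open>\<epsilon> * (r + 1)\<close>. Raising
        \<open>x j0\<close> by \<open>\<epsilon>\<close> adds only \<open>r * \<epsilon>\<close> to
        its left side, so the row stays strict.\<close>
      define \<epsilon> where "\<epsilon> = ((\<Sum>j<n. a j0 j * x j) - r * x j0) / (r + 1)"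
      have \<epsilon>: "0 < \<epsilon>" using j0 r by (simp add: \<epsilon>_def Z_def)
      define y where "y = x(j0 := x j0 + \<epsilon>)"
      have sum_y: "(\<Sum>j<n. a i j * y j) = (\<Sum>j<n. a i j * x j) + a i j0 * \<epsilon>" for i
      proof -
        have "(\<Sum>j<n. a i j * y j) = (\<Sum>j<n. a i j * x j + (if j = j0 then a i j0 * \<epsilon> else 0))"
          by (intro sum.cong) (auto simp: y_def algebra_simps)
        then show ?thesis using j0n by (simp add: sum.distrib)
      qed
      have at_j0: "r * y j0 < (\<Sum>j<n. a j0 j * y j)"
      proof -
        have "(\<Sum>j<n. a j0 j * x j) - r * x j0 = \<epsilon> * (r + 1)"
          using r by (simp add: \<epsilon>_def)
        moreover have "0 \<le> a j0 j0 * \<epsilon>" using a[OF j0n j0n] \<epsilon> by simp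
        ultimately show ?thesis
          using \<epsilon> unfolding sum_y by (simp add: y_def algebra_simps)
      qed
      have mono: "r * y i \<le> r * x i" if "i \<noteq> j0" for i
        using that by (simp add: y_def)
      have inc: "(\<Sum>j<n. a i j * x j) \<le> (\<Sum>j<n. a i j * y j)" if "i < n" for i
        using a[OF that j0n] \<epsilon> by (simp add: sum_y)
      have "feasible y"
        unfolding feasible_def
      proof (intro conjI allI impI)
        show "0 \<le> y i" if "i < n" for i using nn[OF that] \<epsilon> by (auto simp: y_def)
        show "\<exists>i<n. 0 < y i" using nn[OF j0n] \<epsilon> j0n by (auto simp: y_def)
        show "r * y i \<le> (\<Sum>j<n. a i j * y j)" if "i < n" for i
          using at_j0 mono[of i] inc[OF that] le[OF that] by (cases "i = j0") auto
      qed
      moreover have "insert i0 (Z x) \<subseteq> Z y"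
      proof -
        have "r * y i0 < (\<Sum>j<n. a i0 j * y j)"
        proof -
          have "r * y i0 \<le> r * x i0" "r * x i0 \<le> (\<Sum>j<n. a i0 j * x j)"
            using mono[of i0] le[of i0] i0 j0 by auto
          with mult_pos_pos[OF pos \<epsilon>] show ?thesis unfolding sum_y by linarith
        qed
        moreover have "i \<in> Z y" if "i \<in> Z x" for i
          using at_j0 mono[of i] inc[of i] that by (cases "i = j0") (auto simp: Z_def)
        ultimately show ?thesis using i0 by (auto simp: Z_def)
      qed
      then have "card (insert i0 (Z x)) \<le> card (Z y)"
        by (intro card_mono) (auto simp: Z_def)
      moreover have "card (insert i0 (Z x)) = Suc (card (Z x))"
        using i0 by (subst card_insert_disjoint) (auto simp: Z_def)
      ultimately show False using most[of y] by simp
    qed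
    then show ?thesis
      using 3 ZD by (intro disjI2 exI[of _ "{..<n} - Z x"]) auto
  qed
qed

section \<open>Characteristic polynomials of permuted, block triangular and scaled matrices\<close>

lemma signof_mult_self: "signof p * signof p = (1 :: 'a::comm_ring_1)"
  by (simp add: sign_def)

text \<open>The row and the column permutation each contribute \<open>signof p\<close>, and the
  signs cancel. Columns are permuted as rows of the transpose.\<close>

lemma char_poly_permute:
  fixes A :: "'a::comm_ring_1 mat"
  assumes A: "A \<in> carrier_mat n n" and p: "p permutes {0..<n}"
  shows "char_poly (mat n n (\<lambda>(i, j). A $$ (p i, p j))) = char_poly A"
proof -
  define B where "B = char_poly_matrix A"
  have B: "B \<in> carrier_mat n n" using A by (simp add: B_def)
  define C where "C = mat n n (\<lambda>(i, j). B $$ (p i, j))"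
  have C: "C \<in> carrier_mat n n" by (simp add: C_def)
  have lt: "p i < n" if "i < n" for i
    using permutes_in_image[OF p, of i] that by simp
  have inj: "p i = p j \<longleftrightarrow> i = j" for i j
    using permutes_inj[OF p] by (auto dest: injD)
  have "char_poly_matrix (mat n n (\<lambda>(i, j). A $$ (p i, p j))) =
      transpose_mat (mat n n (\<lambda>(i, j). transpose_mat C $$ (p i, j)))"
    by (rule eq_matI) (use A lt in \<open>auto simp: char_poly_matrix_def B_def C_def inj\<close>)
  then have "char_poly (mat n n (\<lambda>(i, j). A $$ (p i, p j))) =
      det (mat n n (\<lambda>(i, j). transpose_mat C $$ (p i, j)))"
    unfolding char_poly_def by (subst (asm) (2) transpose_transpose[symmetric], simp) (subst det_transpose[of _ n], auto)
  also have "\<dots> = signof p * (signof p * det B)"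
    using C by (subst det_permute_rows[OF _ p]) (simp_all add: det_transpose[OF C], simp add: C_def det_permute_rows[OF B p])
  finally show ?thesis
    by (simp add: mult.assoc[symmetric] signof_mult_self B_def char_poly_def)
qed

lemma char_poly_matrix_four_block:
  fixes A :: "'a::comm_ring_1 mat"
  assumes "A \<in> carrier_mat n n" "B \<in> carrier_mat n m" "C \<in> carrier_mat m n" "D \<in> carrier_mat m m"
  shows "char_poly_matrix (four_block_mat A B C D) =
    four_block_mat (char_poly_matrix A) (map_mat (\<lambda>a. [:- a:]) B)
      (map_mat (\<lambda>a. [:- a:]) C) (char_poly_matrix D)"
  by (rule eq_matI) (use assms in \<open>auto simp: char_poly_matrix_def\<close>)

lemma char_poly_four_block_lower_left_zero:
  fixes A :: "'a::idom mat"
  assumes "A \<in> carrier_mat n n" "B \<in> carrier_mat n m" "D \<in> carrier_mat m m"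
  shows "char_poly (four_block_mat A B (0\<^sub>m m n) D) = char_poly A * char_poly D"
proof -
  have "map_mat (\<lambda>a. [:- a:]) (0\<^sub>m m n) = (0\<^sub>m m n :: 'a poly mat)"
    by (rule eq_matI) auto
  then show ?thesis
    unfolding char_poly_def using assms
    by (subst char_poly_matrix_four_block[of _ n _ m]) (auto intro!: det_four_block_mat_lower_left_zero)
qed

lemma char_poly_four_block_upper_right_zero:
  fixes A :: "'a::idom mat"
  assumes "A \<in> carrier_mat n n" "C \<in> carrier_mat m n" "D \<in> carrier_mat m m"
  shows "char_poly (four_block_mat A (0\<^sub>m n m) C D) = char_poly A * char_poly D"
proof -
  have "map_mat (\<lambda>a. [:- a:]) (0\<^sub>m n m) = (0\<^sub>m n m :: 'a poly mat)"
    by (rule eq_matI) auto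
  then show ?thesis
    unfolding char_poly_def using assms
    by (subst char_poly_matrix_four_block[of _ n _ m]) (auto intro!: det_four_block_mat_upper_right_zero)
qed

definition nonneg_mat :: "real mat \<Rightarrow> bool" where
  "nonneg_mat A \<longleftrightarrow> (\<forall>i<dim_row A. \<forall>j<dim_col A. 0 \<le> A $$ (i, j))"

definition row_sums_eq :: "real mat \<Rightarrow> real \<Rightarrow> bool" where
  "row_sums_eq A r \<longleftrightarrow> (\<forall>i<dim_row A. (\<Sum>j<dim_col A. A $$ (i, j)) = r)"

lemma sum_lessThan_add: "(\<Sum>j<m + (n::nat). f j) = (\<Sum>j<m. f j) + (\<Sum>j<n. f (m + j))"
  for f :: "nat \<Rightarrow> 'a::comm_monoid_add"
  by (induction n) (auto simp: add.assoc)

lemma sum_row_four_block: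
  assumes "A \<in> carrier_mat k k" "D \<in> carrier_mat l l" "i < k + l"
  shows "(\<Sum>j<k + l. four_block_mat A B C D $$ (i, j)) =
    (if i < k then (\<Sum>j<k. A $$ (i, j)) + (\<Sum>j<l. B $$ (i, j))
     else (\<Sum>j<k. C $$ (i - k, j)) + (\<Sum>j<l. D $$ (i - k, j)))"
  using assms by (simp add: sum_lessThan_add carrier_matD[OF assms(1)] carrier_matD[OF assms(2)])

text \<open>In a block triangular matrix one off-diagonal block is free. The rows with the smaller
  sum receive the difference in the first column of that block, so the comparison of
  \<open>r1\<close> and \<open>r2\<close> decides which block is zero.\<close>

lemma row_sums_glue:
  fixes A1 A2 :: "real mat"
  assumes A: "A1 \<in> carrier_mat k k" "A2 \<in> carrier_mat l l" "0 < k" "0 < l"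
    and nn: "nonneg_mat A1" "nonneg_mat A2"
    and rs: "row_sums_eq A1 r1" "row_sums_eq A2 r2"
  shows "\<exists>A \<in> carrier_mat (k + l) (k + l). nonneg_mat A \<and> row_sums_eq A (max r1 r2) \<and>
    char_poly A = char_poly A1 * char_poly A2"
proof (cases "r2 \<le> r1")
  case True
  let ?C = "mat l k (\<lambda>(i, j). if j = 0 then r1 - r2 else 0)"
  let ?A = "four_block_mat A1 (0\<^sub>m k l) ?C A2"
  have "row_sums_eq ?A r1"
    using A(3,4) rs
    by (auto simp: row_sums_eq_def sum_row_four_block[OF A(1,2)] carrier_matD[OF A(1)] carrier_matD[OF A(2)]
        simp del: index_mat_four_block(1))
  moreover have "nonneg_mat ?A"
    using A nn True by (auto simp: nonneg_mat_def)
  moreover have "char_poly ?A = char_poly A1 * char_poly A2"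
    using A by (intro char_poly_four_block_upper_right_zero) auto
  ultimately show ?thesis using A True by (intro bexI[of _ ?A]) (auto simp: max_def)
next
  case False
  let ?B = "mat k l (\<lambda>(i, j). if j = 0 then r2 - r1 else 0)"
  let ?A = "four_block_mat A1 ?B (0\<^sub>m l k) A2"
  have "row_sums_eq ?A r2"
    using A(3,4) rs
    by (auto simp: row_sums_eq_def sum_row_four_block[OF A(1,2)] carrier_matD[OF A(1)] carrier_matD[OF A(2)]
        simp del: index_mat_four_block(1))
  moreover have "nonneg_mat ?A"
    using A nn False by (auto simp: nonneg_mat_def)
  moreover have "char_poly ?A = char_poly A1 * char_poly A2"
    using A by (intro char_poly_four_block_lower_left_zero) auto
  ultimately show ?thesis using A False by (intro bexI[of _ ?A]) (auto simp: max_def)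
qed

text \<open>This is conjugation by the diagonal matrix of \<open>x\<close>. For a positive
  eigenvector \<open>x\<close> the new row sums all equal its eigenvalue.\<close>

lemma char_poly_diagonal_scaling:
  fixes A :: "real mat"
  assumes A: "A \<in> carrier_mat n n" and x: "\<And>i. i < n \<Longrightarrow> x i \<noteq> 0"
  shows "char_poly (mat n n (\<lambda>(i, j). A $$ (i, j) * x j / x i)) = char_poly A"
proof -
  let ?B = "mat n n (\<lambda>(i, j). A $$ (i, j) * x j / x i)"
  let ?P = "mat n n (\<lambda>(i, j). if i = j then 1 / x i else 0)"
  let ?Q = "mat n n (\<lambda>(i, j). if i = j then x i else 0)"
  have PQ: "?P * ?Q = 1\<^sub>m n" "?Q * ?P = 1\<^sub>m n"
    by (rule eq_matI; use x in \<open>auto simp: scalar_prod_def if_distrib[of "\<lambda>t. _ * t"] if_distrib[of "\<lambda>t. t * _"] cong: if_cong\<close>)+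
  have "?B = ?P * A * ?Q"
    by (rule eq_matI) (use A in \<open>auto simp: scalar_prod_def if_distrib[of "\<lambda>t. _ * t"] if_distrib[of "\<lambda>t. t * _"] cong: if_cong\<close>)
  then have "similar_mat ?B A"
    using A PQ by (intro similar_matI[of _ _ ?P ?Q n]) auto
  then show ?thesis by (rule char_poly_similar)
qed

lemma permutes_onto_initial_segment:
  assumes S: "S \<subseteq> {0..<n}"
  shows "\<exists>p. p permutes {0..<n} \<and> p ` {0..<card S} = S"
proof -
  have fin: "finite S" using S finite_subset by blast
  have le: "card S \<le> n" using card_mono[OF _ S] by simp
  obtain f where f: "bij_betw f {0..<card S} S"
    using ex_bij_betw_nat_finite[OF fin] by blast
  have "card {card S..<n} = card ({0..<n} - S)"
    using S fin by (simp add: card_Diff_subset)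
  then obtain g where g: "bij_betw g {card S..<n} ({0..<n} - S)"
    by (metis finite_same_card_bij finite_atLeastLessThan finite_Diff)
  define p where "p i = (if i < card S then f i else if i < n then g i else i)" for i
  have "bij_betw p {0..<card S} S"
    using f by (rule bij_betw_cong[THEN iffD1, rotated]) (auto simp: p_def)
  moreover have "bij_betw p {card S..<n} ({0..<n} - S)"
    using g by (rule bij_betw_cong[THEN iffD1, rotated]) (auto simp: p_def)
  ultimately have "bij_betw p ({0..<card S} \<union> {card S..<n}) (S \<union> ({0..<n} - S))"
    by (rule bij_betw_combine) auto
  moreover have "{0..<card S} \<union> {card S..<n} = {0..<n}" "S \<union> ({0..<n} - S) = {0..<n}"
    using le S by auto
  ultimately have "p permutes {0..<n}"
    by (intro bij_imp_permutes) (use le in \<open>auto simp: p_def\<close>)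
  with \<open>bij_betw p {0..<card S} S\<close> show ?thesis
    by (auto simp: bij_betw_def)
qed

text \<open>Cospectral matrices of constant row sums exist without any irreducibility assumption:
  a reducible matrix is split into its diagonal blocks, and the off-diagonal block, which does not
  influence the characteristic polynomial, is used to equalise the row sums.\<close>

theorem cospectral_constant_row_sums:
  assumes "A \<in> carrier_mat n n" "0 < n" "nonneg_mat A"
  shows "\<exists>A' \<in> carrier_mat n n. \<exists>r. nonneg_mat A' \<and> row_sums_eq A' r \<and> char_poly A' = char_poly A"
  using assms
proof (induction n arbitrary: A rule: less_induct)
  case (less n)
  note A = less.prems(1)
  have nn: "0 \<le> A $$ (i, j)" if "i < n" "j < n" for i j
    using less.prems that by (auto simp: nonneg_mat_def)
  from positive_eigenvector_or_reducible[of n "\<lambda>i j. A $$ (i, j)", OF less.prems(2) nn]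
  consider r x where "\<forall>i<n. 0 < x i" "\<forall>i<n. (\<Sum>j<n. A $$ (i, j) * x j) = r * x i"
    | S where "S \<subseteq> {..<n}" "S \<noteq> {}" "S \<noteq> {..<n}" "\<forall>i\<in>S. \<forall>j\<in>{..<n} - S. A $$ (i, j) = 0"
    by blast
  then show ?case
  proof cases
    case 1
    let ?B = "mat n n (\<lambda>(i, j). A $$ (i, j) * x j / x i)"
    have xpos: "0 < x i" if "i < n" for i using 1 that by blast
    have "nonneg_mat ?B"
      using nn xpos by (auto simp: nonneg_mat_def less_imp_le)
    moreover have "row_sums_eq ?B r"
      using 1(2) xpos by (auto simp: row_sums_eq_def sum_divide_distrib[symmetric] less_imp_neq[symmetric])
    moreover have "char_poly ?B = char_poly A"
      using xpos by (intro char_poly_diagonal_scaling[OF A]) (metis less_irrefl)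
    ultimately show ?thesis by (intro bexI[of _ ?B]) auto
  next
    case 2
    define k where "k = card S"
    obtain p where p: "p permutes {0..<n}" "p ` {0..<k} = S"
      using permutes_onto_initial_segment[of S n] 2(1) by (auto simp: k_def atLeast0LessThan)
    have fin: "finite S" using 2(1) finite_subset by blast
    have k: "0 < k" "k < n"
      using 2 fin psubset_card_mono[of "{..<n}" S] by (auto simp: k_def card_gt_0_iff)
    define l where "l = n - k"
    have n: "n = k + l" and l: "0 < l" "l < n" using k by (auto simp: l_def)
    have lt: "p i < n" if "i < n" for i
      using permutes_in_image[OF p(1), of i] that by simp
    have inS: "p i \<in> S \<longleftrightarrow> i < k" if "i < n" for i
    proof
      assume "p i \<in> S"
      then obtain i' where "i' < k" "p i = p i'" using p(2) by auto
      then show "i < k" using permutes_inj[OF p(1)] by (auto dest: injD)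
    qed (use p(2) in auto)
    define B where "B = mat n n (\<lambda>(i, j). A $$ (p i, p j))"
    define B1 where "B1 = mat k k (\<lambda>(i, j). A $$ (p i, p j))"
    define B2 where "B2 = mat l l (\<lambda>(i, j). A $$ (p (k + i), p (k + j)))"
    \<comment> \<open>Rows in \<open>S\<close> vanish outside \<open>S\<close>; once
      \<open>S\<close> is moved to the front, the upper right block is zero.\<close>
    have B: "B = four_block_mat B1 (0\<^sub>m k l) (mat l k (\<lambda>(i, j). A $$ (p (k + i), p j))) B2"
    proof (rule eq_matI)
      fix i j assume ij: "i < dim_row (four_block_mat B1 (0\<^sub>m k l) (mat l k (\<lambda>(i, j). A $$ (p (k + i), p j))) B2)"
        "j < dim_col (four_block_mat B1 (0\<^sub>m k l) (mat l k (\<lambda>(i, j). A $$ (p (k + i), p j))) B2)"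
      then have "A $$ (p i, p j) = 0" if "i < k" "\<not> j < k"
        using 2(4) inS[of i] inS[of j] lt[of j] that by (auto simp: B1_def B2_def n)
      with ij show "B $$ (i, j) = four_block_mat B1 (0\<^sub>m k l) (mat l k (\<lambda>(i, j). A $$ (p (k + i), p j))) B2 $$ (i, j)"
        by (auto simp: B_def B1_def B2_def n)
    qed (auto simp: B_def B1_def B2_def n)
    have "char_poly A = char_poly B"
      unfolding B_def by (rule char_poly_permute[OF A p(1), symmetric])
    also have "\<dots> = char_poly B1 * char_poly B2"
      unfolding B by (rule char_poly_four_block_upper_right_zero) (auto simp: B1_def B2_def)
    finally have char: "char_poly A = char_poly B1 * char_poly B2" .
    have "nonneg_mat B1" "nonneg_mat B2"
      using nn lt k n by (auto simp: nonneg_mat_def B1_def B2_def)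
    then obtain A1 A2 r1 r2 where
      "A1 \<in> carrier_mat k k" "nonneg_mat A1" "row_sums_eq A1 r1" "char_poly A1 = char_poly B1"
      "A2 \<in> carrier_mat l l" "nonneg_mat A2" "row_sums_eq A2 r2" "char_poly A2 = char_poly B2"
      using less.IH[of k B1] less.IH[of l B2] k l by (auto simp: B1_def B2_def)
    \<comment> \<open>The old lower left block is discarded: only the product of the two
      characteristic polynomials has to survive.\<close>
    with row_sums_glue[of A1 k A2 l r1 r2] k l char show ?thesis
      unfolding n by auto
  qed
qed

section \<open>Gluing along a two-dimensional invariant subspace\<close>

text \<open>For \<open>c\<close> constantly 1 this is a companion matrix with respect to the Newton
  basis with nodes \<open>e\<close>. The entry type is general because the characteristic matrix has
  the same shape over polynomials.\<close>

definition chain_mat :: "nat \<Rightarrow> (nat \<Rightarrow> 'a) \<Rightarrow> (nat \<Rightarrow> 'a) \<Rightarrow> (nat \<Rightarrow> 'a) \<Rightarrow> 'a::zero mat" where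
  "chain_mat n e c w = mat (Suc n) (Suc n) (\<lambda>(i, j). if i = n then w j
     else if j = i then e i else if j = Suc i then c i else 0)"

lemma chain_mat_carrier [simp]: "chain_mat n e c w \<in> carrier_mat (Suc n) (Suc n)"
  by (simp add: chain_mat_def)

text \<open>Laplace expansion along the first column, where only the first and the last row
  contribute. Deleting the first row leaves a shorter chain matrix, deleting the last one a lower
  triangular matrix with diagonal \<open>c\<close>.\<close>

lemma det_chain_mat:
  "det (chain_mat n e c w) = (\<Sum>j\<le>n. (-1)^(n - j) * (\<Prod>i<j. e i) * (\<Prod>i\<in>{j..<n}. c i) * w j)"
  for w :: "nat \<Rightarrow> 'a::comm_ring_1"
proof (induction n arbitrary: e c w)
  case 0
  have "det (chain_mat 0 e c w) = chain_mat 0 e c w $$ (0, 0)"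
    by (rule det_single) (use chain_mat_carrier[of 0] in auto)
  then show ?case by (simp add: chain_mat_def)
next
  case (Suc n)
  let ?H = "chain_mat (Suc n) e c w"
  have "det ?H = (\<Sum>i<Suc (Suc n). ?H $$ (i, 0) * cofactor ?H i 0)"
    by (rule laplace_expansion_column) auto
  also have "\<dots> = (\<Sum>i\<in>{0, Suc n}. ?H $$ (i, 0) * cofactor ?H i 0)"
    by (rule sum.mono_neutral_right) (auto simp: chain_mat_def)
  also have "\<dots> = e 0 * cofactor ?H 0 0 + w 0 * cofactor ?H (Suc n) 0"
    by (simp add: chain_mat_def)
  also have "cofactor ?H 0 0 = det (chain_mat n (\<lambda>i. e (Suc i)) (\<lambda>i. c (Suc i)) (\<lambda>i. w (Suc i)))"
  proof -
    have "mat_delete ?H 0 0 = chain_mat n (\<lambda>i. e (Suc i)) (\<lambda>i. c (Suc i)) (\<lambda>i. w (Suc i))"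
      by (rule eq_matI) (auto simp: mat_delete_def chain_mat_def)
    then show ?thesis by (simp add: cofactor_def)
  qed
  also have "cofactor ?H (Suc n) 0 = (-1)^(Suc n) * (\<Prod>i\<in>{0..<Suc n}. c i)"
  proof -
    have "det (mat_delete ?H (Suc n) 0) = prod_list (diag_mat (mat_delete ?H (Suc n) 0))"
      by (rule det_lower_triangular[of "Suc n"])
        (auto simp: mat_delete_def chain_mat_def)
    also have "\<dots> = (\<Prod>i\<in>{0..<Suc n}. c i)"
      unfolding prod_list_diag_prod
      by (rule prod.cong) (auto simp: mat_delete_def chain_mat_def)
    finally show ?thesis by (simp add: cofactor_def)
  qed
  also have "e 0 * det (chain_mat n (\<lambda>i. e (Suc i)) (\<lambda>i. c (Suc i)) (\<lambda>i. w (Suc i))) =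
     (\<Sum>j\<le>n. (-1)^(Suc n - Suc j) * (\<Prod>i<Suc j. e i) * (\<Prod>i\<in>{Suc j..<Suc n}. c i) * w (Suc j))"
    unfolding Suc.IH sum_distrib_left
    by (intro sum.cong refl)
      (simp add: prod.lessThan_Suc_shift prod.shift_bounds_Suc_ivl mult_ac del: prod.lessThan_Suc prod.op_ivl_Suc)
  also have "w 0 * ((-1)^(Suc n) * (\<Prod>i\<in>{0..<Suc n}. c i)) =
      (-1)^(Suc n - 0) * (\<Prod>i<0. e i) * (\<Prod>i\<in>{0..<Suc n}. c i) * w 0"
    by (simp only: diff_zero lessThan_0 prod.empty mult_1_right mult_1_left mult_ac)
  finally show ?case
    unfolding sum.atMost_Suc_shift by (subst add.commute)
qed

lemma prod_pCons_const: "(\<Prod>i\<in>A. [:c i:]) = [:\<Prod>i\<in>A. c i:]"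
  for c :: "'b \<Rightarrow> 'a::comm_ring_1"
  by (induction A rule: infinite_finite_induct) (auto simp: one_pCons)

text \<open>The characteristic matrix is a chain matrix with superdiagonal \<open>- c i\<close>. The
  signs of these entries cancel those of the determinant formula, leaving the single minus of
  \<open>- w j\<close>.\<close>

lemma char_poly_chain_mat:
  fixes w :: "nat \<Rightarrow> 'a::comm_ring_1"
  shows "char_poly (chain_mat n e c w) = (\<Prod>i<n. [:- e i, 1:]) * [:- w n, 1:] -
    (\<Sum>j<n. Polynomial.smult ((\<Prod>i\<in>{j..<n}. c i) * w j) (\<Prod>i<j. [:- e i, 1:]))"
proof -
  have eq: "char_poly_matrix (chain_mat n e c w) =
      chain_mat n (\<lambda>i. [:- e i, 1:]) (\<lambda>i. [:- c i:]) (\<lambda>j. if j = n then [:- w n, 1:] else [:- w j:])"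
    by (rule eq_matI) (auto simp: char_poly_matrix_def chain_mat_def)
  have "(- 1)^(n - j) * P * (\<Prod>i\<in>{j..<n}. [:- c i:]) * [:- w j:] =
      - Polynomial.smult ((\<Prod>i\<in>{j..<n}. c i) * w j) P" for j and P :: "'a poly"
  proof -
    have "(\<Prod>i\<in>{j..<n}. [:- c i:]) = (\<Prod>i\<in>{j..<n}. (- 1) * [:c i:])"
      by simp
    also have "\<dots> = (- 1)^(n - j) * [:\<Prod>i\<in>{j..<n}. c i:]"
      unfolding prod.distrib prod_constant by (simp add: prod_pCons_const)
    finally have "(- 1)^(n - j) * P * (\<Prod>i\<in>{j..<n}. [:- c i:]) * [:- w j:] =
        ((- 1)^(n - j) * (- 1)^(n - j)) * (P * ([:\<Prod>i\<in>{j..<n}. c i:] * [:- w j:]))"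
      by (simp only: mult_ac)
    also have "(- 1)^(n - j) * (- 1)^(n - j) = (1 :: 'a poly)"
      by (simp flip: power_mult_distrib)
    finally show ?thesis by (simp add: mult_ac)
  qed
  then have "(\<Sum>j<n. (- 1)^(n - j) * (\<Prod>i<j. [:- e i, 1:]) * (\<Prod>i\<in>{j..<n}. [:- c i:]) *
        (if j = n then [:- w n, 1:] else [:- w j:])) =
      - (\<Sum>j<n. Polynomial.smult ((\<Prod>i\<in>{j..<n}. c i) * w j) (\<Prod>i<j. [:- e i, 1:]))"
    unfolding sum_negf[symmetric] by (intro sum.cong refl) (simp only: lessThan_iff nat_neq_iff if_False simp_thms, simp)
  then show ?thesis
    unfolding char_poly_def eq det_chain_mat
    by (simp only: lessThan_Suc_atMost[symmetric] sum.lessThan_Suc) simp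
qed

text \<open>With F and W the matrices of \<open>f\<close> and \<open>w\<close>, the assumptions say
  F (I; W) = (I; W) M. So the columns of (I; W) span an invariant subspace on which F acts as
  \<open>M\<close>, and the second factor belongs to the action F22 - W F12 on the quotient.\<close>

lemma char_poly_block_similarity:
  fixes f :: "nat \<Rightarrow> nat \<Rightarrow> 'a::field"
  assumes M: "M \<in> carrier_mat n n"
    and top: "\<And>i j. i < n \<Longrightarrow> j < n \<Longrightarrow> f i j + (\<Sum>s<l. f i (n + s) * w s j) = M $$ (i, j)"
    and bottom: "\<And>s j. s < l \<Longrightarrow> j < n \<Longrightarrow>
      f (n + s) j + (\<Sum>t<l. f (n + s) (n + t) * w t j) = (\<Sum>i<n. w s i * M $$ (i, j))"
  shows "char_poly (mat (n + l) (n + l) (\<lambda>(i, j). f i j)) =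
    char_poly M * char_poly (mat l l (\<lambda>(s, t). f (n + s) (n + t) - (\<Sum>i<n. w s i * f i (n + t))))"
proof -
  define F11 where "F11 = mat n n (\<lambda>(i, j). f i j)"
  define F12 where "F12 = mat n l (\<lambda>(i, t). f i (n + t))"
  define F21 where "F21 = mat l n (\<lambda>(s, j). f (n + s) j)"
  define F22 where "F22 = mat l l (\<lambda>(s, t). f (n + s) (n + t))"
  define W where "W = mat l n (\<lambda>(s, j). w s j)"
  define B where "B = mat l l (\<lambda>(s, t). f (n + s) (n + t) - (\<Sum>i<n. w s i * f i (n + t)))"
  note defs = F11_def F12_def F21_def F22_def W_def B_def
  have [simp]: "F11 \<in> carrier_mat n n" "F12 \<in> carrier_mat n l" "F21 \<in> carrier_mat l n"
    "F22 \<in> carrier_mat l l" "W \<in> carrier_mat l n" "B \<in> carrier_mat l l"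
    by (simp_all add: defs)
  note [simp] = M
  let ?N = "four_block_mat F11 F12 F21 F22"
  let ?D = "four_block_mat M F12 (0\<^sub>m l n) B"
  let ?T = "four_block_mat (1\<^sub>m n) (0\<^sub>m n l) W (1\<^sub>m l)"
  let ?T' = "four_block_mat (1\<^sub>m n) (0\<^sub>m n l) (- W) (1\<^sub>m l)"
  have one: "four_block_mat (1\<^sub>m n) (0\<^sub>m n l) (0\<^sub>m l n) (1\<^sub>m l) = (1\<^sub>m (n + l) :: 'a mat)"
    by (rule eq_matI) auto
  have inv: "W + - W = 0\<^sub>m l n" "- W + W = 0\<^sub>m l n"
    by (rule eq_matI; auto simp: W_def)+
  have mult_unit: "1\<^sub>m a * X = X" "X * 1\<^sub>m b = X" "0\<^sub>m c a * X = 0\<^sub>m c b" "X * 0\<^sub>m b c = 0\<^sub>m a c"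
    if "X \<in> carrier_mat a b" for X :: "'a mat" and a b c
    using that by auto
  have [simp]: "W * M + 0\<^sub>m l n = W * M"
    by (rule right_add_zero_mat) (rule mult_carrier_mat[OF \<open>W \<in> _\<close> M])
  have "- W \<in> carrier_mat l n" by simp
  note units = mult_unit[OF \<open>F11 \<in> _\<close>] mult_unit[OF \<open>F12 \<in> _\<close>] mult_unit[OF \<open>F21 \<in> _\<close>]
    mult_unit[OF \<open>F22 \<in> _\<close>] mult_unit[OF \<open>W \<in> _\<close>] mult_unit[OF M]
    mult_unit[OF \<open>B \<in> _\<close>] mult_unit[OF \<open>- W \<in> _\<close>]
  have TT': "?T * ?T' = 1\<^sub>m (n + l)"
    by (subst mult_four_block_mat[where ?nr1.0 = n and ?n1.0 = n and ?n2.0 = l and ?nr2.0 = l and ?nc1.0 = n and ?nc2.0 = l]) (simp_all add: units one inv)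
  have T'T: "?T' * ?T = 1\<^sub>m (n + l)"
    by (subst mult_four_block_mat[where ?nr1.0 = n and ?n1.0 = n and ?n2.0 = l and ?nr2.0 = l and ?nc1.0 = n and ?nc2.0 = l]) (simp_all add: units one inv)
  \<comment> \<open>The first columns of \<open>?T\<close> are (I; W), so conjugation by
    \<open>?T\<close> makes \<open>?N\<close> block triangular.\<close>
  have NT: "?N * ?T = ?T * ?D"
  proof -
    have 1: "F11 + F12 * W = M"
      by (rule eq_matI) (use carrier_matD[OF M] top in \<open>auto simp: defs scalar_prod_def atLeast0LessThan\<close>)
    have 2: "F21 + F22 * W = W * M"
      by (rule eq_matI) (use carrier_matD[OF M] bottom in \<open>auto simp: defs scalar_prod_def atLeast0LessThan\<close>)
    have 3: "W * F12 + B = F22"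
      by (rule eq_matI) (auto simp: defs scalar_prod_def atLeast0LessThan)
    have "?N * ?T = four_block_mat M F12 (W * M) F22"
      by (subst mult_four_block_mat[where ?nr1.0 = n and ?n1.0 = n and ?n2.0 = l and ?nr2.0 = l and ?nc1.0 = n and ?nc2.0 = l]) (simp_all add: units 1 2)
    also have "\<dots> = ?T * ?D"
      by (subst mult_four_block_mat[where ?nr1.0 = n and ?n1.0 = n and ?n2.0 = l and ?nr2.0 = l and ?nc1.0 = n and ?nc2.0 = l]) (simp_all add: units 3)
    finally show ?thesis .
  qed
  have "?N = ?N * (?T * ?T')"
    unfolding TT' by (rule right_mult_one_mat[symmetric, of _ "n + l"]) simp_all
  also have "\<dots> = ?N * ?T * ?T'"
    by (rule assoc_mult_mat[symmetric, of _ "n + l" "n + l" _ "n + l" _ "n + l"]) simp_all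
  finally have "?N = ?T * ?D * ?T'" unfolding NT .
  moreover have "{?N, ?D, ?T, ?T'} \<subseteq> carrier_mat (n + l) (n + l)" by simp
  ultimately have "similar_mat ?N ?D" using TT' T'T by (intro similar_matI)
  then have "char_poly ?N = char_poly ?D" by (rule char_poly_similar)
  also have "\<dots> = char_poly M * char_poly B"
    by (rule char_poly_four_block_lower_left_zero) simp_all
  also have "?N = mat (n + l) (n + l) (\<lambda>(i, j). f i j)"
    by (rule eq_matI) (auto simp: defs)
  finally show ?thesis by (simp add: B_def)
qed

section \<open>Bordering a matrix along an invariant plane\<close>

lemma sum_lessThan_2: "(\<Sum>j<2. f j) = f 0 + f 1"
  for f :: "nat \<Rightarrow> 'a::comm_monoid_add"
  by (simp add: numeral_2_eq_2)

text \<open>Let X have columns \<open>x\<close>, \<open>y\<close> and let C be the trailing block of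
  \<open>M\<close>, so A X = X C. The bordered matrix acts as \<open>M\<close> on the column space
  of diag(I, X), and on the quotient exactly as \<open>A\<close> acts modulo the columns of X. The
  polynomial \<open>q\<close> belongs to this common quotient.\<close>

lemma glue_along_invariant_plane:
  fixes A M :: "real mat" and x y :: "nat \<Rightarrow> real"
  assumes A: "A \<in> carrier_mat (2 + l) (2 + l)" "nonneg_mat A"
    and M: "M \<in> carrier_mat (k + 2) (k + 2)" "nonneg_mat M"
    and x: "\<And>i. i < 2 + l \<Longrightarrow> 0 \<le> x i" "x 0 = 1" "x 1 = 0"
    and y: "\<And>i. i < 2 + l \<Longrightarrow> 0 \<le> y i" "y 0 = 0" "y 1 = 1"
    and Ax: "\<And>i. i < 2 + l \<Longrightarrow>
      (\<Sum>j<2 + l. A $$ (i, j) * x j) = x i * M $$ (k, k) + y i * M $$ (k + 1, k)"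
    and Ay: "\<And>i. i < 2 + l \<Longrightarrow>
      (\<Sum>j<2 + l. A $$ (i, j) * y j) = x i * M $$ (k, k + 1) + y i * M $$ (k + 1, k + 1)"
  shows "\<exists>N\<in>carrier_mat (k + 2 + l) (k + 2 + l). nonneg_mat N \<and>
    (\<exists>q. char_poly N = char_poly M * q \<and>
         char_poly A = char_poly (mat 2 2 (\<lambda>(a, b). M $$ (k + a, k + b))) * q)"
proof -
  \<comment> \<open>The first \<open>k\<close> indices are new. As rows 0 and 1 of X form the
    identity, the new rows can copy \<open>M\<close> using only columns 0 and 1 of the old part; the
    new columns are X times the lower left block of \<open>M\<close>.\<close>
  define f where "f i j = (if i < k then if j < k + 2 then M $$ (i, j) else 0
      else if j < k then x (i - k) * M $$ (k, j) + y (i - k) * M $$ (k + 1, j)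
      else A $$ (i - k, j - k))" for i j
  define N where "N = mat (k + 2 + l) (k + 2 + l) (\<lambda>(i, j). f i j)"
  define wA where "wA s j = (if j = 0 then x (2 + s) else y (2 + s))" for s j :: nat
  define wN where "wN s j = (if j < k then 0 else wA s (j - k))" for s j :: nat
  have Ax': "A $$ (i, 0) + (\<Sum>s<l. A $$ (i, 2 + s) * x (2 + s)) =
      x i * M $$ (k, k) + y i * M $$ (k + 1, k)" if "i < 2 + l" for i
    using Ax[OF that, unfolded sum_lessThan_add sum_lessThan_2] x(2,3) by simp
  have Ay': "A $$ (i, 1) + (\<Sum>s<l. A $$ (i, 2 + s) * y (2 + s)) =
      x i * M $$ (k, k + 1) + y i * M $$ (k + 1, k + 1)" if "i < 2 + l" for i
    using Ay[OF that, unfolded sum_lessThan_add sum_lessThan_2] y(2,3) by simp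
  have AwA: "A $$ (i, b) + (\<Sum>s<l. A $$ (i, 2 + s) * wA s b) =
      x i * M $$ (k, k + b) + y i * M $$ (k + 1, k + b)" if "i < 2 + l" "b < 2" for i b
    using Ax'[OF that(1)] Ay'[OF that(1)] that(2) by (auto simp: wA_def less_2_cases_iff)
  have M0: "x a * M $$ (k, j) + y a * M $$ (k + 1, j) = M $$ (k + a, j)" if "a < 2" for a j
    using that x y by (auto simp: less_2_cases_iff)
  let ?C = "mat 2 2 (\<lambda>(a, b). M $$ (k + a, k + b))"
  let ?q = "char_poly (mat l l (\<lambda>(s, t). A $$ (2 + s, 2 + t) - (\<Sum>i<2. wA s i * A $$ (i, 2 + t))))"
  have "char_poly (mat (2 + l) (2 + l) (\<lambda>(i, j). A $$ (i, j))) = char_poly ?C * ?q"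
  proof (rule char_poly_block_similarity)
    fix i j :: nat assume "i < 2" "j < 2"
    then show "A $$ (i, j) + (\<Sum>s<l. A $$ (i, 2 + s) * wA s j) = ?C $$ (i, j)"
      using AwA[of i j] M0[of i "k + j"] by simp
  next
    fix s j :: nat assume "s < l" "j < 2"
    then show "A $$ (2 + s, j) + (\<Sum>t<l. A $$ (2 + s, 2 + t) * wA t j) = (\<Sum>i<2. wA s i * ?C $$ (i, j))"
      using AwA[of "2 + s" j] by (simp add: sum_lessThan_2 wA_def)
  qed auto
  also have "mat (2 + l) (2 + l) (\<lambda>(i, j). A $$ (i, j)) = A"
    by (rule eq_matI) (use A in auto)
  finally have charA: "char_poly A = char_poly ?C * ?q" .
  have sum_wN: "(\<Sum>i<k + 2. wN s i * g i) = x (2 + s) * g k + y (2 + s) * g (k + 1)" for s g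
    by (simp add: sum_lessThan_add sum_lessThan_2 wN_def wA_def)
  have "char_poly N = char_poly M * char_poly (mat l l (\<lambda>(s, t).
      f (k + 2 + s) (k + 2 + t) - (\<Sum>i<k + 2. wN s i * f i (k + 2 + t))))"
    unfolding N_def
  proof (rule char_poly_block_similarity)
    fix i j assume ij: "i < k + 2" "j < k + 2"
    show "f i j + (\<Sum>s<l. f i (k + 2 + s) * wN s j) = M $$ (i, j)"
    proof (cases "i < k")
      case False
      define a where "a = i - k"
      have a: "i = k + a" "a < 2" using False ij by (auto simp: a_def)
      show ?thesis
      proof (cases "j < k")
        case True
        then show ?thesis using M0[of a j] a by (simp add: f_def wN_def)
      next
        case False
        define b where "b = j - k"
        have b: "j = k + b" "b < 2" using False ij by (auto simp: b_def)
        show ?thesis using AwA[of a b] M0[of a "k + b"] a b by (simp add: f_def wN_def)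
      qed
    qed (use ij in \<open>simp add: f_def\<close>)
  next
    fix s j assume sj: "s < l" "j < k + 2"
    show "f (k + 2 + s) j + (\<Sum>t<l. f (k + 2 + s) (k + 2 + t) * wN t j) =
        (\<Sum>i<k + 2. wN s i * M $$ (i, j))"
      unfolding sum_wN
    proof (cases "j < k")
      case False
      define b where "b = j - k"
      have b: "j = k + b" "b < 2" using False sj by (auto simp: b_def)
      show "f (k + 2 + s) j + (\<Sum>t<l. f (k + 2 + s) (k + 2 + t) * wN t j) =
          x (2 + s) * M $$ (k, j) + y (2 + s) * M $$ (k + 1, j)"
        using AwA[of "2 + s" b] b sj by (simp add: f_def wN_def)
    qed (simp add: f_def wN_def)
  qed (use M in auto)
  \<comment> \<open>\<open>wN\<close> vanishes on the new indices, so bordering does not change the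
    quotient block.\<close>
  also have "mat l l (\<lambda>(s, t). f (k + 2 + s) (k + 2 + t) - (\<Sum>i<k + 2. wN s i * f i (k + 2 + t))) =
      mat l l (\<lambda>(s, t). A $$ (2 + s, 2 + t) - (\<Sum>i<2. wA s i * A $$ (i, 2 + t)))"
    unfolding sum_wN sum_lessThan_2 by (rule eq_matI) (auto simp: f_def wA_def)
  finally have charN: "char_poly N = char_poly M * ?q" .
  have nn: "0 \<le> f i j" if "i < k + 2 + l" "j < k + 2 + l" for i j
  proof -
    have "0 \<le> M $$ (a, b)" if "a < k + 2" "b < k + 2" for a b
      using M that by (auto simp: nonneg_mat_def)
    moreover have "0 \<le> A $$ (a, b)" if "a < 2 + l" "b < 2 + l" for a b
      using A that by (auto simp: nonneg_mat_def)
    ultimately show ?thesis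
      using that x(1)[of "i - k"] y(1)[of "i - k"] by (auto simp: f_def)
  qed
  show ?thesis
    using charA charN nn by (intro bexI[of _ N]) (auto simp: N_def nonneg_mat_def)
qed

lemma char_poly_mat_2:
  "char_poly (mat 2 2 f) = [:- f (0, 0), 1:] * [:- f (1, 1), 1:] - [:f (0, 1) * f (1, 0):]"
  for f :: "nat \<times> nat \<Rightarrow> 'a::comm_ring_1"
proof -
  have "mat 2 2 f = chain_mat 1 (\<lambda>_. f (0, 0)) (\<lambda>_. f (0, 1)) (\<lambda>j. f (1, j))"
    by (rule eq_matI) (auto simp: chain_mat_def numeral_2_eq_2 less_Suc_eq)
  then show ?thesis by (simp add: char_poly_chain_mat one_pCons)
qed

section \<open>Nonnegative matrices with prescribed block and characteristic polynomial\<close>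

lemma pcompose_conv_sum: "degree p \<le> n \<Longrightarrow> p \<circ>\<^sub>p q = (\<Sum>i\<le>n. Polynomial.smult (coeff p i) (q ^ i))"
  for p :: "'a::comm_ring_1 poly"
proof -
  assume n: "degree p \<le> n"
  have "p \<circ>\<^sub>p q = (\<Sum>i\<le>n. monom (coeff p i) i) \<circ>\<^sub>p q"
    using poly_as_sum_of_monoms'[OF n] by simp
  also have "\<dots> = (\<Sum>i\<le>n. Polynomial.smult (coeff p i) (q ^ i))"
    unfolding pcompose_sum
    by (intro sum.cong refl) (simp add: monom_altdef pcompose_smult pcompose_hom.hom_power pcompose_pCons)
  finally show ?thesis .
qed

text \<open>The new vertices form a path that ends at the first vertex of the given \<open>2 \<times> 2\<close> block and can be
  entered from its second one, so every new cycle passes through the entry \<open>c01\<close>; a cycle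
  omitting \<open>j\<close> of the path's vertices accounts for the coefficient of \<open>(X - d) ^ j\<close>.\<close>

lemma companion_extension:
  fixes p :: "real poly"
  assumes nn: "0 \<le> d" "0 \<le> c00" "0 < c01" "0 \<le> c10" "0 \<le> c11"
    and deg: "degree p = k + 2" "coeff p (k + 2) = 1"
    and c1: "coeff p (k + 1) = - (c00 + c11 - 2 * d)"
    and c2: "coeff p k = (c00 - d) * (c11 - d) - c01 * c10"
    and c: "\<And>j. j < k \<Longrightarrow> coeff p j \<le> 0"
  shows "\<exists>M\<in>carrier_mat (k + 2) (k + 2). nonneg_mat M \<and> char_poly M = p \<circ>\<^sub>p [:- d, 1:] \<and>
    M $$ (k, k) = c00 \<and> M $$ (k, k + 1) = c01 \<and> M $$ (k + 1, k) = c10 \<and> M $$ (k + 1, k + 1) = c11"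
proof -
  define e where "e i = (if i < k then d else c00)" for i
  define s where "s i = (if i < k then 1 else c01)" for i
  \<comment> \<open>For \<open>j < k\<close> the characteristic polynomial contains
    \<open>w j\<close> multiplied by the path weight \<open>c01\<close>. Division by
    \<open>c01\<close> therefore leaves exactly \<open>coeff p j\<close> at (X - d)^j.\<close>
  define w where "w j = (if j < k then - coeff p j / c01 else if j = k then c10 else c11)" for j
  let ?M = "chain_mat (k + 1) e s w" and ?Y = "[:- d, 1:]"
  have "nonneg_mat ?M"
    using nn c by (auto simp: nonneg_mat_def chain_mat_def e_def s_def w_def divide_nonpos_pos)
  moreover have "char_poly ?M = p \<circ>\<^sub>p ?Y"
  proof -
    have pe: "(\<Prod>i<j. [:- e i, 1:]) = ?Y ^ j" if "j \<le> k" for j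
    proof -
      have "(\<Prod>i<j. [:- e i, 1:]) = (\<Prod>i<j. ?Y)"
        by (rule prod.cong) (use that in \<open>auto simp: e_def\<close>)
      then show ?thesis by simp
    qed
    have ps: "(\<Prod>i\<in>{j..<k + 1}. s i) = c01" if "j \<le> k" for j
    proof -
      have "(\<Prod>i\<in>{j..<k}. s i) = 1" by (rule prod.neutral) (auto simp: s_def)
      then show ?thesis using that by (simp add: s_def)
    qed
    have last: "(\<Sum>j<k + 1. Polynomial.smult ((\<Prod>i\<in>{j..<k + 1}. s i) * w j) (\<Prod>i<j. [:- e i, 1:])) =
        (\<Sum>j<k. Polynomial.smult (- coeff p j) (?Y ^ j)) + Polynomial.smult (c01 * c10) (?Y ^ k)"
    proof -
      have "(\<Sum>j<k. Polynomial.smult ((\<Prod>i\<in>{j..<k + 1}. s i) * w j) (\<Prod>i<j. [:- e i, 1:])) =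
          (\<Sum>j<k. Polynomial.smult (- coeff p j) (?Y ^ j))"
        by (intro sum.cong refl) (use nn in \<open>simp only: ps pe less_imp_le lessThan_iff, simp add: w_def\<close>)
      moreover have "Polynomial.smult ((\<Prod>i\<in>{k..<k + 1}. s i) * w k) (\<Prod>i<k. [:- e i, 1:]) =
          Polynomial.smult (c01 * c10) (?Y ^ k)"
        by (simp only: ps pe order_refl, simp add: w_def)
      ultimately show ?thesis by (simp only: Suc_eq_plus1[symmetric] sum.lessThan_Suc)
    qed
    have top: "(\<Prod>i<k + 1. [:- e i, 1:]) * [:- w (k + 1), 1:] = ?Y ^ k * ([:- c00, 1:] * [:- c11, 1:])"
      by (simp only: Suc_eq_plus1[symmetric] prod.lessThan_Suc pe order_refl mult.assoc)
        (simp add: e_def w_def)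
    \<comment> \<open>The assumptions on the two coefficients below the leading one say that the top
      part of \<open>p\<close>, in powers of X - d, is the characteristic polynomial of the
      block.\<close>
    have quad: "[:- c00, 1:] * [:- c11, 1:] - [:c01 * c10:] =
        ?Y ^ 2 + Polynomial.smult (coeff p (k + 1)) ?Y + [:coeff p k:]"
      unfolding c1 c2 by (simp add: power2_eq_square algebra_simps)
    have "char_poly ?M = ?Y ^ k * ([:- c00, 1:] * [:- c11, 1:] - [:c01 * c10:]) +
        (\<Sum>j<k. Polynomial.smult (coeff p j) (?Y ^ j))"
    proof -
      have "?Y ^ k * [:c01 * c10:] = Polynomial.smult (c01 * c10) (?Y ^ k)" by simp
      then show ?thesis
        unfolding char_poly_chain_mat last top
        by (simp only: right_diff_distrib smult_minus_left sum_negf)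
    qed
    also have "\<dots> = ?Y ^ (k + 2) + Polynomial.smult (coeff p (k + 1)) (?Y ^ (k + 1)) +
        Polynomial.smult (coeff p k) (?Y ^ k) + (\<Sum>j<k. Polynomial.smult (coeff p j) (?Y ^ j))"
    proof -
      have "q ^ k * (q ^ 2 + Polynomial.smult a q + [:b:]) =
          q ^ (k + 2) + Polynomial.smult a (q ^ (k + 1)) + Polynomial.smult b (q ^ k)" for q :: "real poly" and a b
        by (simp add: distrib_left power_add mult_ac power2_eq_square)
      then show ?thesis unfolding quad by (simp only:)
    qed
    also have "\<dots> = p \<circ>\<^sub>p ?Y"
      using deg pcompose_conv_sum[of p "k + 2" ?Y]
      by (simp add: numeral_2_eq_2 lessThan_Suc_atMost[symmetric] del: power_Suc)
    finally show ?thesis .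
  qed
  ultimately show ?thesis
    by (intro bexI[of _ ?M]) (auto simp: chain_mat_def e_def s_def w_def numeral_2_eq_2)
qed

section \<open>Eigenvectors and invariant planes for constant row sums\<close>

lemma real_eigenvector_exists:
  fixes A :: "real mat"
  assumes A: "A \<in> carrier_mat n n" and root: "poly (char_poly A) \<kappa> = 0"
  obtains v where "\<And>i. i < n \<Longrightarrow> (\<Sum>j<n. A $$ (i, j) * v j) = \<kappa> * v i" "\<exists>i<n. v i \<noteq> 0"
proof -
  from root obtain u where u: "eigenvector A u \<kappa>"
    using eigenvalue_root_char_poly[OF A] by (auto simp: eigenvalue_def)
  then have uc: "u \<in> carrier_vec n" and u0: "u \<noteq> 0\<^sub>v n" and Au: "A *\<^sub>v u = \<kappa> \<cdot>\<^sub>v u"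
    using A by (auto simp: eigenvector_def)
  show thesis
  proof (rule that[of "\<lambda>i. u $ i"])
    show "(\<Sum>j<n. A $$ (i, j) * u $ j) = \<kappa> * u $ i" if "i < n" for i
    proof -
      have "(A *\<^sub>v u) $ i = \<kappa> * u $ i" using that uc by (simp add: Au)
      then show ?thesis using that A uc by (simp add: scalar_prod_def atLeast0LessThan)
    qed
    show "\<exists>i<n. u $ i \<noteq> 0"
    proof (rule ccontr)
      assume "\<not> ?thesis"
      then have "u = 0\<^sub>v n" using uc by (intro eq_vecI) auto
      with u0 show False by simp
    qed
  qed
qed

lemma ex_argmax_lessThan:
  fixes f :: "nat \<Rightarrow> real"
  assumes "0 < n"
  obtains i where "i < n" "\<And>j. j < n \<Longrightarrow> f j \<le> f i"
proof -
  have "Max (f ` {..<n}) \<in> f ` {..<n}" using assms by (intro Max_in) auto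
  then obtain i where "i < n" "f i = Max (f ` {..<n})" by auto
  then show thesis by (intro that[of i]) auto
qed

text \<open>Take the eigenvector equation in a row where the eigenvector has its largest
  modulus.\<close>

lemma row_sum_bounds_eigenvalue:
  assumes A: "A \<in> carrier_mat n n" "nonneg_mat A" "row_sums_eq A r"
    and root: "poly (char_poly A) \<kappa> = 0"
  shows "\<bar>\<kappa>\<bar> \<le> r"
proof -
  obtain v where v: "\<And>i. i < n \<Longrightarrow> (\<Sum>j<n. A $$ (i, j) * v j) = \<kappa> * v i" "\<exists>i<n. v i \<noteq> 0"
    using real_eigenvector_exists[OF A(1) root] by blast
  have "0 < n" using v(2) by auto
  then obtain i where i: "i < n" "\<And>j. j < n \<Longrightarrow> \<bar>v j\<bar> \<le> \<bar>v i\<bar>"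
    using ex_argmax_lessThan[of n "\<lambda>i. \<bar>v i\<bar>"] by blast
  have nn: "0 \<le> A $$ (i, j)" if "j < n" for j
    using A i(1) that by (auto simp: nonneg_mat_def)
  have "\<bar>\<kappa>\<bar> * \<bar>v i\<bar> = \<bar>\<Sum>j<n. A $$ (i, j) * v j\<bar>"
    by (simp add: v(1)[OF i(1)] abs_mult)
  also have "\<dots> \<le> (\<Sum>j<n. A $$ (i, j) * \<bar>v i\<bar>)"
    by (rule order.trans[OF sum_abs]) (intro sum_mono, use nn i in \<open>auto simp: abs_mult intro: mult_left_mono\<close>)
  also have "\<dots> = r * \<bar>v i\<bar>"
    using A i(1) by (auto simp: row_sums_eq_def sum_distrib_right[symmetric])
  finally have "\<bar>\<kappa>\<bar> * \<bar>v i\<bar> \<le> r * \<bar>v i\<bar>" .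
  moreover have "0 < \<bar>v i\<bar>" using v(2) i(2) by fastforce
  ultimately show ?thesis by simp
qed

lemma row_sum_is_root:
  assumes A: "A \<in> carrier_mat n n" "row_sums_eq A r" and n: "0 < n"
  shows "poly (char_poly A) r = 0"
proof -
  let ?v = "vec n (\<lambda>_. 1 :: real)"
  have "A *\<^sub>v ?v = r \<cdot>\<^sub>v ?v"
    by (rule eq_vecI) (use A in \<open>auto simp: row_sums_eq_def scalar_prod_def atLeast0LessThan\<close>)
  moreover have "?v \<noteq> 0\<^sub>v n"
  proof
    assume "?v = 0\<^sub>v n"
    then have "?v $ 0 = 0\<^sub>v n $ 0" by (rule arg_cong)
    with n show False by simp
  qed
  ultimately have "eigenvector A ?v r" using A by (simp add: eigenvector_def)
  then show ?thesis using eigenvalue_root_char_poly[OF A(1)] by (auto simp: eigenvalue_def)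
qed

lemma permutes_two_points:
  fixes i j n :: nat
  assumes "i < n" "j < n" "i \<noteq> j"
  obtains p where "p permutes {0..<n}" "p 0 = i" "p 1 = j"
proof -
  \<comment> \<open>The outer transposition sends \<open>j'\<close> to \<open>j\<close>. As
    \<open>i \<noteq> j\<close>, \<open>j'\<close> is not 0, so the inner transposition fixes
    0.\<close>
  define j' where "j' = Transposition.transpose 0 i j"
  have j': "j' \<noteq> 0" "j' < n"
    using assms by (auto simp: j'_def Transposition.transpose_def)
  have "Transposition.transpose 0 i \<circ> Transposition.transpose 1 j' permutes {0..<n}"
    using assms j' by (intro permutes_compose permutes_swap_id) auto
  moreover have "(Transposition.transpose 0 i \<circ> Transposition.transpose 1 j') 0 = i"
    using j' by (simp add: Transposition.transpose_def)
  moreover have "(Transposition.transpose 0 i \<circ> Transposition.transpose 1 j') 1 = j"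
    by (simp add: j'_def)
  ultimately show thesis by (rule that)
qed

text \<open>The cone of nonnegative vectors in the span of the all-ones vector and an eigenvector \<open>v\<close>
  is spanned by \<open>v - min v\<close> and \<open>max v - v\<close>. Each of them vanishes at an index where the other one
  does not, so the matrix of \<open>A\<close> in this basis consists of entries of nonnegative vectors.\<close>

lemma invariant_plane_extreme_rays:
  assumes A: "A \<in> carrier_mat n n" "nonneg_mat A" "row_sums_eq A r"
    and root: "poly (char_poly A) \<kappa> = 0" and ne: "\<kappa> \<noteq> r"
  obtains A' x y c00 c01 c10 c11 where
    "2 \<le> n" "A' \<in> carrier_mat n n" "nonneg_mat A'" "char_poly A' = char_poly A"
    "\<And>i. i < n \<Longrightarrow> 0 \<le> x i" "x 0 = 1" "x 1 = 0"
    "\<And>i. i < n \<Longrightarrow> 0 \<le> y i" "y 0 = 0" "y 1 = 1"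
    "0 \<le> c00" "0 < c01" "0 \<le> c10" "0 \<le> c11"
    "c00 + c11 = r + \<kappa>" "c00 * c11 - c01 * c10 = r * \<kappa>"
    "\<And>i. i < n \<Longrightarrow> (\<Sum>j<n. A' $$ (i, j) * x j) = x i * c00 + y i * c10"
    "\<And>i. i < n \<Longrightarrow> (\<Sum>j<n. A' $$ (i, j) * y j) = x i * c01 + y i * c11"
proof -
  obtain u where u: "\<And>i. i < n \<Longrightarrow> (\<Sum>j<n. A $$ (i, j) * u j) = \<kappa> * u i" "\<exists>i<n. u i \<noteq> 0"
    using real_eigenvector_exists[OF A(1) root] by blast
  have rs: "(\<Sum>j<n. A $$ (i, j)) = r" if "i < n" for i
    using A that by (auto simp: row_sums_eq_def)
  \<comment> \<open>A nonzero constant vector has eigenvalue \<open>r\<close>, which differs from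
    \<open>\<kappa>\<close>.\<close>
  have nonconst: "\<not> (\<forall>i<n. w i = c)"
    if w: "\<And>i. i < n \<Longrightarrow> (\<Sum>j<n. A $$ (i, j) * w j) = \<kappa> * w i" "\<exists>i<n. w i \<noteq> 0" for w c
  proof
    assume const: "\<forall>i<n. w i = c"
    obtain i where i: "i < n" "w i \<noteq> 0" using w(2) by blast
    have "\<kappa> * c = (\<Sum>j<n. A $$ (i, j) * c)" using w(1)[OF i(1)] const i by simp
    also have "\<dots> = r * c" by (simp add: sum_distrib_right[symmetric] rs[OF i(1)])
    finally show False using ne const i by auto
  qed
  \<comment> \<open>The eigenvector is negated if its minimum is 0, so that the minimum
    \<open>v i\<close> is nonzero. This makes \<open>c01\<close>, a multiple of
    \<open>(\<kappa> - r) * v i\<close>, nonzero.\<close>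
  have "\<exists>v i j. (\<forall>i<n. (\<Sum>j<n. A $$ (i, j) * v j) = \<kappa> * v i) \<and> i < n \<and> j < n \<and>
      (\<forall>k<n. v i \<le> v k) \<and> (\<forall>k<n. v k \<le> v j) \<and> v i < v j \<and> v i \<noteq> 0"
  proof -
    have n: "0 < n" using u(2) by auto
    obtain j where j: "j < n" "\<And>k. k < n \<Longrightarrow> u k \<le> u j"
      using ex_argmax_lessThan[OF n, of u] by blast
    obtain i where i: "i < n" "\<And>k. k < n \<Longrightarrow> u i \<le> u k"
      using ex_argmax_lessThan[OF n, of "\<lambda>k. - u k"] by auto
    have "u i \<noteq> u j"
      using nonconst[of u "u j"] u i j by (metis order_antisym)
    with i j have ij: "u i < u j" by (simp add: less_le)
    show ?thesis
    proof (cases "u i = 0")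
      case False
      then show ?thesis using u(1) i j ij by blast
    next
      case True
      then show ?thesis using u(1) i j ij
        by (intro exI[of _ "\<lambda>i. - u i"] exI[of _ j] exI[of _ i]) (auto simp: sum_negf)
    qed
  qed
  then obtain v i j where v: "\<And>i. i < n \<Longrightarrow> (\<Sum>j<n. A $$ (i, j) * v j) = \<kappa> * v i"
    and ij: "i < n" "j < n" "\<And>k. k < n \<Longrightarrow> v i \<le> v k" "\<And>k. k < n \<Longrightarrow> v k \<le> v j" "v i < v j" "v i \<noteq> 0"
    by blast
  obtain p where p: "p permutes {0..<n}" "p 0 = i" "p 1 = j"
    using permutes_two_points[of i n j] ij by blast
  have lt: "p k < n" if "k < n" for k
    using permutes_in_image[OF p(1), of k] that by simp
  define D where "D = v j - v i"
  have D: "0 < D" using ij by (simp add: D_def)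
  define A' where "A' = mat n n (\<lambda>(i, j). A $$ (p i, p j))"
  define x where "x k = (v j - v (p k)) / D" for k
  define y where "y k = (v (p k) - v i) / D" for k
  \<comment> \<open>The permutation puts the minimum of \<open>v\<close> at index 0 and the maximum
    at index 1, where \<open>x\<close>, \<open>y\<close> are unit vectors. So the coordinates of the
    images of \<open>x\<close> and \<open>y\<close> are simply their entries at these
    indices.\<close>
  define c00 where "c00 = (r * v j - \<kappa> * v i) / D"
  define c10 where "c10 = (r * v j - \<kappa> * v j) / D"
  define c01 where "c01 = (\<kappa> * v i - r * v i) / D"
  define c11 where "c11 = (\<kappa> * v j - r * v i) / D"
  have perm: "(\<Sum>t<n. g (p t)) = (\<Sum>t<n. g t)" for g :: "nat \<Rightarrow> real"
    using sum.permute[OF p(1), of g] by (simp add: atLeast0LessThan)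
  have Ax: "(\<Sum>t<n. A' $$ (k, t) * x t) = (r * v j - \<kappa> * v (p k)) / D" if k: "k < n" for k
  proof -
    have "(\<Sum>t<n. A' $$ (k, t) * x t) = (\<Sum>t<n. A $$ (p k, p t) * ((v j - v (p t)) / D))"
      using k by (simp add: A'_def x_def)
    also have "\<dots> = (\<Sum>t<n. A $$ (p k, t) * ((v j - v t) / D))"
      by (rule perm)
    also have "\<dots> = ((\<Sum>t<n. A $$ (p k, t)) * v j - (\<Sum>t<n. A $$ (p k, t) * v t)) / D"
      by (simp add: sum_distrib_right right_diff_distrib sum_subtractf sum_divide_distrib diff_divide_distrib)
    finally show ?thesis using rs v lt[OF k] by simp
  qed
  have Ay: "(\<Sum>t<n. A' $$ (k, t) * y t) = (\<kappa> * v (p k) - r * v i) / D" if k: "k < n" for k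
  proof -
    have "(\<Sum>t<n. A' $$ (k, t) * y t) = (\<Sum>t<n. A $$ (p k, p t) * ((v (p t) - v i) / D))"
      using k by (simp add: A'_def y_def)
    also have "\<dots> = (\<Sum>t<n. A $$ (p k, t) * ((v t - v i) / D))"
      by (rule perm)
    also have "\<dots> = ((\<Sum>t<n. A $$ (p k, t) * v t) - (\<Sum>t<n. A $$ (p k, t)) * v i) / D"
      by (simp add: sum_distrib_right right_diff_distrib sum_subtractf sum_divide_distrib diff_divide_distrib)
    finally show ?thesis using rs v lt[OF k] by simp
  qed
  have n2: "2 \<le> n" using ij by (cases "n = 1") auto
  then have n01: "0 < n" "1 < n" by auto
  have x0: "0 \<le> x k" and y0: "0 \<le> y k" if "k < n" for k
    using ij lt[OF that] D by (simp_all add: x_def y_def)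
  have A'0: "0 \<le> A' $$ (k, t)" if "k < n" "t < n" for k t
    using A that lt by (auto simp: A'_def nonneg_mat_def)
  have pos: "0 \<le> (\<Sum>t<n. A' $$ (k, t) * z t)" if "k < n" "\<And>t. t < n \<Longrightarrow> 0 \<le> z t" for k z
    using that A'0 by (intro sum_nonneg mult_nonneg_nonneg) auto
  show thesis
  proof (rule that[of A' x y c00 c01 c10 c11])
    show "char_poly A' = char_poly A"
      unfolding A'_def by (rule char_poly_permute[OF A(1) p(1)])
    show "x 0 = 1" "x 1 = 0" "y 0 = 0" "y 1 = 1"
      using D p by (simp_all add: x_def y_def D_def)
    show "0 \<le> c00" "0 \<le> c10" "0 \<le> c11"
      using pos[OF n01(1), of x] pos[OF n01(2), of x] pos[OF n01(2), of y]
      by (simp_all add: Ax Ay n01 x0 y0 p c00_def c10_def c11_def del: One_nat_def)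
    have "0 \<le> c01"
      using pos[OF n01(1), of y] by (simp add: Ay n01 y0 p c01_def)
    moreover have "c01 \<noteq> 0" using ne ij D by (simp add: c01_def)
    ultimately show "0 < c01" by simp
    show "c00 + c11 = r + \<kappa>"
      using D by (simp add: c00_def c11_def field_simps) (simp add: D_def algebra_simps)
    show "c00 * c11 - c01 * c10 = r * \<kappa>"
    proof -
      have "(r * v j - \<kappa> * v i) * (\<kappa> * v j - r * v i) - (\<kappa> * v i - r * v i) * (r * v j - \<kappa> * v j) = r * \<kappa> * (D * D)"
        by (simp add: D_def algebra_simps)
      then have "c00 * c11 - c01 * c10 = r * \<kappa> * (D * D) / (D * D)"
        by (simp add: c00_def c01_def c10_def c11_def diff_divide_distrib[symmetric])
      then show ?thesis using D by simp
    qed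
    show "(\<Sum>t<n. A' $$ (k, t) * x t) = x k * c00 + y k * c10" if "k < n" for k
    proof -
      have "(r * v j - \<kappa> * v (p k)) * D = (v j - v (p k)) * (r * v j - \<kappa> * v i) + (v (p k) - v i) * (r * v j - \<kappa> * v j)"
        by (simp add: D_def algebra_simps)
      then have "x k * c00 + y k * c10 = (r * v j - \<kappa> * v (p k)) * D / (D * D)"
        by (simp only: x_def y_def c00_def c10_def times_divide_times_eq add_divide_distrib)
      then show ?thesis using D by (simp add: Ax[OF that])
    qed
    show "(\<Sum>t<n. A' $$ (k, t) * y t) = x k * c01 + y k * c11" if "k < n" for k
    proof -
      have "(\<kappa> * v (p k) - r * v i) * D = (v j - v (p k)) * (\<kappa> * v i - r * v i) + (v (p k) - v i) * (\<kappa> * v j - r * v i)"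
        by (simp add: D_def algebra_simps)
      then have "x k * c01 + y k * c11 = (\<kappa> * v (p k) - r * v i) * D / (D * D)"
        by (simp only: x_def y_def c01_def c11_def times_divide_times_eq add_divide_distrib)
      then show ?thesis using D by (simp add: Ay[OF that])
    qed
  qed (use n2 x0 y0 A'0 in \<open>auto simp: A'_def nonneg_mat_def\<close>)
qed

section \<open>Replacing two eigenvalues\<close>

lemma proots_prod_linear: "proots (\<Prod>z\<in>#Z. [:- z, 1:]) = Z"
  for Z :: "'a::idom multiset"
proof (induction Z)
  case (add x Z)
  have "(\<Prod>z\<in>#Z. [:- z, 1:]) \<noteq> 0" by (auto simp: prod_mset_zero_iff)
  then have "proots ([:- x, 1:] * (\<Prod>z\<in>#Z. [:- z, 1:])) = {#x#} + Z"
    by (subst proots_mult) (auto simp: add)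
  then show ?case by (simp del: mult_pCons_left)
qed auto

lemma pcompose_prod_linear:
  "(\<Prod>z\<in>#Z. [:- z, 1:]) \<circ>\<^sub>p [:- d, 1:] = (\<Prod>z\<in>#Z. [:- (z + d), 1:])"
  for d :: "'a::idom"
proof (induction Z)
  case (add x Z)
  have "[:- x, 1:] \<circ>\<^sub>p [:- d, 1:] = [:- (x + d), 1:]" by (simp add: pcompose_pCons)
  then show ?case by (simp add: pcompose_mult add del: mult_pCons_left)
qed (simp add: pcompose_1)

text \<open>The product over \<open>W\<close> is (X - \<mu>) g with g the product over
  \<open>Z\<close>. The assumptions \<open>0 \<le> s1\<close> and \<open>s1\<^sup>2 \<le> s2\<close>
  are the two inequalities between the top coefficients of g from which the ratio bound gives the
  sign of all lower coefficients.\<close>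

lemma coeffs_nonpos_of_power_sums:
  fixes \<mu> s1 s2 :: real and Z :: "complex multiset"
  defines "W \<equiv> add_mset (complex_of_real \<mu>) Z"
  assumes Z: "image_mset cnj Z = Z" "\<And>z. z \<in># Z \<Longrightarrow> Re z \<le> 0"
    and n: "size W = k + 2"
    and sums: "(\<Sum>z\<in>#W. z) = complex_of_real s1" "(\<Sum>z\<in>#W. z\<^sup>2) = complex_of_real s2"
    and s: "0 \<le> s1" "s1\<^sup>2 \<le> s2"
  obtains p where "map_poly complex_of_real p = (\<Prod>z\<in>#W. [:- z, 1:])"
    "degree p = k + 2" "coeff p (k + 2) = 1" "coeff p (k + 1) = - s1" "2 * coeff p k = s1\<^sup>2 - s2"
    "\<And>j. j < k \<Longrightarrow> coeff p j \<le> 0"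
proof -
  obtain g where g: "map_poly complex_of_real g = (\<Prod>z\<in>#Z. [:- z, 1:])" "hurwitz_seq (icoeff g)"
    using cnj_closed_prod_real[OF Z] by blast
  define p where "p = [:- \<mu>, 1:] * g"
  have p: "map_poly complex_of_real p = (\<Prod>z\<in>#W. [:- z, 1:])"
    by (simp add: p_def W_def of_real_poly_hom.hom_mult g map_poly_pCons del: mult_pCons_left)
  have real_icoeff: "icoeff (map_poly complex_of_real q) i = complex_of_real (icoeff q i)" for q i
    by (simp add: icoeff_def coeff_map_poly)
  note pW = icoeff_prod_linear[of W, folded p, unfolded n real_icoeff sums]
  have p_hi: "icoeff p i = 0" if "int (k + 2) < i" for i
    using pW(1)[OF that] by simp
  have p_top: "icoeff p (int (k + 2)) = 1"
    using pW(2) by (metis of_real_1 of_real_eq_iff)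
  have p_1: "icoeff p (int (k + 2) - 1) = - s1"
    using pW(3) by (metis of_real_minus of_real_eq_iff)
  have p_2: "2 * icoeff p (int (k + 2) - 2) = s1\<^sup>2 - s2"
  proof -
    have "complex_of_real (2 * icoeff p (int (k + 2) - 2)) = complex_of_real (s1\<^sup>2 - s2)"
      using pW(4) by simp
    then show ?thesis by (simp only: of_real_eq_iff)
  qed
  have p_g: "icoeff p i = icoeff g (i - 1) - \<mu> * icoeff g i" for i
    by (simp add: p_def icoeff_linear_mult del: mult_pCons_left)
  have "size Z = k + 1" using n by (simp add: W_def)
  then have "icoeff g (int (k + 1)) = 1"
    using icoeff_prod_linear(2)[of Z, folded g(1), unfolded real_icoeff] by (metis of_real_1 of_real_eq_iff)
  moreover have "icoeff g (int (k + 1) - 1) \<le> \<mu>"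
    using p_1 p_g[of "int (k + 1)"] s(1) \<open>icoeff g (int (k + 1)) = 1\<close> by simp
  moreover have "icoeff g (int (k + 1) - 2) \<le> \<mu> * icoeff g (int (k + 1) - 1)"
    using p_2 p_g[of "int k"] s(2) by simp
  ultimately have "icoeff g (int j - 1) \<le> \<mu> * icoeff g (int j)" if "j < k" for j
    using that by (intro hurwitz_seq_ratio_bound[OF g(2), of "int (k + 1)"]) auto
  then have low: "coeff p j \<le> 0" if "j < k" for j
    using p_g[of "int j"] that by simp
  have top: "coeff p (k + 2) = 1"
    using p_top by (simp only: icoeff_of_nat)
  have "degree p \<le> k + 2"
    using p_hi[of "int i" for i] by (intro degree_le) (simp only: icoeff_of_nat of_nat_less_iff, simp)
  moreover have "k + 2 \<le> degree p"
    using top by (intro le_degree) simp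
  ultimately have "degree p = k + 2" by simp
  moreover have "coeff p (k + 1) = - s1"
    using p_1 icoeff_of_nat[of p "k + 1"] by simp
  moreover have "2 * coeff p k = s1\<^sup>2 - s2"
    using p_2 by simp
  ultimately show thesis using that p top low by blast
qed

section \<open>Perron realisations and the exchange of two eigenvalues\<close>

lemma realises_root_iff:
  assumes "realises A xs"
  shows "z \<in> set xs \<longleftrightarrow> poly (map_poly complex_of_real (char_poly A)) z = 0"
proof -
  have A: "A \<in> carrier_mat (length xs) (length xs)"
    and pr: "proots (char_poly (map_mat complex_of_real A)) = mset xs"
    using assms by (auto simp: realises_def)
  have "char_poly (map_mat complex_of_real A) \<noteq> 0"
    using degree_monic_char_poly[of "map_mat complex_of_real A" "length xs"] A by auto
  then have "{z. poly (char_poly (map_mat complex_of_real A)) z = 0} = set xs"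
    by (metis pr set_count_proots set_mset_mset)
  then show ?thesis
    by (auto simp: of_real_hom.char_poly_hom[OF A])
qed

text \<open>A cospectral matrix has constant row sum \<open>r\<close>. Its eigenvalue
  \<open>\<rho>\<close> is at most \<open>r\<close>, while \<open>r\<close> is itself an eigenvalue
  and so at most the spectral radius \<open>\<rho>\<close>.\<close>

lemma perron_realisation:
  assumes real: "realisable (complex_of_real \<rho> # xs)" and perron: "perron_eigenvalue \<rho> (complex_of_real \<rho> # xs)"
  obtains A where "realises A (complex_of_real \<rho> # xs)" "row_sums_eq A \<rho>"
proof -
  let ?xs = "complex_of_real \<rho> # xs" and ?n = "length (complex_of_real \<rho> # xs)"
  obtain B where B: "realises B ?xs" and sr: "\<rho> = spectral_radius (map_mat complex_of_real B)"
    using perron by (auto simp: perron_eigenvalue_def)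
  have Bc: "B \<in> carrier_mat ?n ?n" and "nonneg_mat B"
    using B by (auto simp: realises_def nonneg_mat_def)
  then obtain A r where A: "A \<in> carrier_mat ?n ?n" "nonneg_mat A" "row_sums_eq A r" "char_poly A = char_poly B"
    using cospectral_constant_row_sums[of B ?n] by auto
  have rA: "realises A ?xs"
    using A B unfolding realises_def
    by (auto simp: of_real_hom.char_poly_hom[OF A(1)] of_real_hom.char_poly_hom[OF Bc] nonneg_mat_def)
  have "poly (char_poly A) \<rho> = 0"
    using realises_root_iff[OF rA, of "complex_of_real \<rho>"] by simp
  then have "\<rho> \<le> r"
    using row_sum_bounds_eigenvalue[OF A(1-3)] by fastforce
  moreover have "r \<le> \<rho>"
  proof -
    have "poly (char_poly B) r = 0"
      using row_sum_is_root[OF A(1,3)] A(4) by simp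
    then have "complex_of_real r \<in> spectrum (map_mat complex_of_real B)"
      using Bc by (subst spectrum_root_char_poly[of _ ?n]) (auto simp: of_real_hom.char_poly_hom[OF Bc])
    then have "norm (complex_of_real r) \<in> norm ` spectrum (map_mat complex_of_real B)"
      by (rule imageI)
    then have "norm (complex_of_real r) \<le> \<rho>"
      unfolding sr by (rule spectral_radius_mem_max(2)[of _ ?n, rotated 2]) (use Bc in auto)
    then show ?thesis by simp
  qed
  ultimately show thesis using that rA A(3) by simp
qed

theorem theorem2p10:
  fixes m n :: nat
    and \<rho> \<delta> :: real
    and lam mu :: "nat \<Rightarrow> complex"
  assumes "m \<ge> 2" and "n \<ge> 3"
    and "realisable (complex_of_real \<rho> # map lam [2..<Suc m])"
    and "perron_eigenvalue \<rho> (complex_of_real \<rho> # map lam [2..<Suc m])"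
    and "lam 2 \<in> \<real>"
    and "complex_of_real \<rho> \<noteq> lam 2"
    and "(real n - 2) * max 0 (Re (lam 2)) \<le> \<delta>"
    and "\<delta> \<le> 1 / 2 * (real n - 2) * (\<rho> + Re (lam 2))"
    and "conjugation_closed (map mu [1..<Suc n])"
    and "mu 1 \<in> \<real>\<^sub>\<ge>\<^sub>0"
    and "\<And>i. i \<in> {2..n} \<Longrightarrow> Re (mu i) \<le> \<delta> / (real n - 2)"
    and "(\<Sum>i=1..n. mu i) = complex_of_real \<rho> + lam 2 + complex_of_real \<delta>"
    and "(\<Sum>i=1..n. (mu i)\<^sup>2) =
           (complex_of_real \<rho>)\<^sup>2 + (lam 2)\<^sup>2 + complex_of_real (\<delta>\<^sup>2 / (real n - 2))"
  shows "realisable (map mu [1..<Suc n] @ map lam [3..<Suc m])"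
proof -
  define l where "l = m - 2"
  define k where "k = n - 2"
  have m: "m = 2 + l" and n: "n = k + 2" and k: "0 < k" and rk: "real n - 2 = real k"
    using assms(1,2) by (auto simp: l_def k_def)
  obtain \<kappa> where \<kappa>: "lam 2 = complex_of_real \<kappa>"
    using assms(5) by (auto elim: Reals_cases)
  let ?ls = "map lam [3..<Suc m]"
  have lam: "map lam [2..<Suc m] = complex_of_real \<kappa> # ?ls"
  proof -
    have "[2..<Suc m] = 2 # [Suc 2..<Suc m]" using m by (intro upt_conv_Cons) simp
    then show ?thesis by (simp add: \<kappa> del: upt_Suc)
  qed
  \<comment> \<open>Subtracting \<open>d\<close> moves \<open>mu 2\<close>, ..., \<open>mu n\<close>
    into the closed left half plane.\<close>
  define d where "d = \<delta> / real k"
  have \<delta>: "\<delta> = real k * d" using k by (simp add: d_def)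
  have d: "0 \<le> d" "\<kappa> \<le> d" "2 * d \<le> \<rho> + \<kappa>"
    using assms(7,8) k by (auto simp: rk \<kappa> \<delta>)
  obtain A where A: "realises A (complex_of_real \<rho> # complex_of_real \<kappa> # ?ls)" "row_sums_eq A \<rho>"
    using perron_realisation[OF assms(3,4)] unfolding lam by blast
  have len: "length (complex_of_real \<rho> # complex_of_real \<kappa> # ?ls) = 2 + l" by (simp add: m del: upt_Suc)
  have Ac: "A \<in> carrier_mat (2 + l) (2 + l)" "nonneg_mat A"
    using A(1) unfolding realises_def len by (auto simp: nonneg_mat_def)
  have root: "poly (char_poly A) \<kappa> = 0"
    using realises_root_iff[OF A(1), of "complex_of_real \<kappa>"] by simp
  have "\<kappa> \<noteq> \<rho>" using assms(6) \<kappa> by auto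
  then have "\<kappa> < \<rho>" using row_sum_bounds_eigenvalue[OF Ac A(2) root] by auto
  obtain A' x y c00 c01 c10 c11 where "2 \<le> 2 + l" and A': "A' \<in> carrier_mat (2 + l) (2 + l)" "nonneg_mat A'"
      "char_poly A' = char_poly A"
    and x: "\<And>i. i < 2 + l \<Longrightarrow> 0 \<le> x i" "x 0 = 1" "x 1 = 0"
    and y: "\<And>i. i < 2 + l \<Longrightarrow> 0 \<le> y i" "y 0 = 0" "y 1 = 1"
    and c: "0 \<le> c00" "0 < c01" "0 \<le> c10" "0 \<le> c11"
      "c00 + c11 = \<rho> + \<kappa>" "c00 * c11 - c01 * c10 = \<rho> * \<kappa>"
    and Ax: "\<And>i. i < 2 + l \<Longrightarrow> (\<Sum>j<2 + l. A' $$ (i, j) * x j) = x i * c00 + y i * c10"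
    and Ay: "\<And>i. i < 2 + l \<Longrightarrow> (\<Sum>j<2 + l. A' $$ (i, j) * y j) = x i * c01 + y i * c11"
    by (rule invariant_plane_extreme_rays[OF Ac A(2) root \<open>\<kappa> \<noteq> \<rho>\<close>]) (rule that; assumption)

  define Z where "Z = mset (map (\<lambda>i. mu i - complex_of_real d) [2..<Suc n])"
  define \<mu> where "\<mu> = Re (mu 1) - d"
  have mu1: "mu 1 = complex_of_real (Re (mu 1))"
    using assms(10) by (auto simp: nonneg_Reals_def)
  have upt: "[1..<Suc n] = 1 # [2..<Suc n]"
    using n upt_conv_Cons[of 1 "Suc n"] by (simp add: numeral_2_eq_2 del: upt_Suc)
  define W where "W = add_mset (complex_of_real \<mu>) Z"
  have W: "W = image_mset (\<lambda>z. z - complex_of_real d) (mset (map mu [1..<Suc n]))"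
    unfolding W_def Z_def upt by (simp add: \<mu>_def mu1[symmetric] multiset.map_comp o_def del: One_nat_def)
  have sum_W: "(\<Sum>z\<in>#W. h z) = (\<Sum>i=1..n. h (mu i - complex_of_real d))" for h :: "complex \<Rightarrow> complex"
    unfolding W by (simp add: multiset.map_comp o_def sum_unfold_sum_mset atLeastLessThanSuc_atLeastAtMost
        mset_upt del: upt_Suc)
  \<comment> \<open>The shift is real, so \<open>W\<close> inherits closure under conjugation; its
    real element \<open>\<mu>\<close> can be removed on both sides.\<close>
  have Zcnj: "image_mset cnj Z = Z"
  proof -
    have "image_mset cnj W = image_mset (\<lambda>z. z - complex_of_real d) (image_mset cnj (mset (map mu [1..<Suc n])))"
      unfolding W by (simp add: multiset.map_comp o_def del: upt_Suc)
    also have "\<dots> = W"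
      using assms(9) unfolding W conjugation_closed_def mset_map by (simp only:)
    finally have "image_mset cnj W = W" .
    then show ?thesis by (simp add: W_def)
  qed
  have ZRe: "Re z \<le> 0" if "z \<in># Z" for z
    using assms(11) that by (auto simp: Z_def rk d_def)
  have sizeW: "size W = k + 2"
    by (simp add: W_def Z_def n del: upt_Suc)
  \<comment> \<open>As \<open>\<delta> = real k * d\<close>, the shifted list has the same first two
    power sums as \<open>\<rho> - d\<close>, \<open>\<kappa> - d\<close> and \<open>k\<close>
    zeros.\<close>
  have sumW1: "(\<Sum>z\<in>#W. z) = complex_of_real (\<rho> + \<kappa> - 2 * d)"
  proof -
    have "(\<Sum>z\<in>#W. z) = (\<Sum>i=1..n. mu i) - of_nat n * complex_of_real d"
      unfolding sum_W by (simp add: sum_subtractf)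
    also have "\<dots> = complex_of_real (\<rho> + \<kappa> + \<delta> - real n * d)"
      unfolding assms(12) by (simp add: \<kappa>)
    also have "\<rho> + \<kappa> + \<delta> - real n * d = \<rho> + \<kappa> - 2 * d"
      by (simp add: \<delta> n algebra_simps)
    finally show ?thesis .
  qed
  have sumW2: "(\<Sum>z\<in>#W. z\<^sup>2) = complex_of_real ((\<rho> - d)\<^sup>2 + (\<kappa> - d)\<^sup>2)"
  proof -
    have "(\<Sum>z\<in>#W. z\<^sup>2) = (\<Sum>i=1..n. (mu i)\<^sup>2 - 2 * complex_of_real d * mu i + (complex_of_real d)\<^sup>2)"
      unfolding sum_W by (intro sum.cong refl) (simp add: power2_eq_square algebra_simps)
    also have "\<dots> = (\<Sum>i=1..n. (mu i)\<^sup>2) - 2 * complex_of_real d * (\<Sum>i=1..n. mu i) + of_nat n * (complex_of_real d)\<^sup>2"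
      by (simp add: sum.distrib sum_subtractf sum_distrib_left)
    also have "\<dots> = complex_of_real (\<rho>\<^sup>2 + \<kappa>\<^sup>2 + \<delta>\<^sup>2 / real k - 2 * d * (\<rho> + \<kappa> + \<delta>) + real n * d\<^sup>2)"
      unfolding assms(12,13) by (simp add: \<kappa> rk)
    also have "\<rho>\<^sup>2 + \<kappa>\<^sup>2 + \<delta>\<^sup>2 / real k - 2 * d * (\<rho> + \<kappa> + \<delta>) + real n * d\<^sup>2 = (\<rho> - d)\<^sup>2 + (\<kappa> - d)\<^sup>2"
    proof -
      have "\<delta>\<^sup>2 / real k = real k * d\<^sup>2" using k by (simp add: \<delta> power2_eq_square)
      then show ?thesis by (simp add: \<delta> n power2_eq_square algebra_simps)
    qed
    finally show ?thesis .
  qed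
  \<comment> \<open>Left minus right side is twice \<open>(\<rho> - d) * (\<kappa> - d)\<close>, and
    \<open>d\<close> lies between \<open>\<kappa>\<close> and \<open>\<rho>\<close>.\<close>
  have square_le: "(\<rho> + \<kappa> - 2 * d)\<^sup>2 \<le> (\<rho> - d)\<^sup>2 + (\<kappa> - d)\<^sup>2"
  proof -
    have "(\<rho> - d) * (\<kappa> - d) \<le> 0" using d \<open>\<kappa> < \<rho>\<close> by (intro mult_nonneg_nonpos) auto
    then show ?thesis by (simp add: power2_eq_square algebra_simps)
  qed
  have trace: "0 \<le> \<rho> + \<kappa> - 2 * d" using d(3) by simp
  obtain p where p: "map_poly complex_of_real p = (\<Prod>z\<in>#W. [:- z, 1:])"
    "degree p = k + 2" "coeff p (k + 2) = 1" "coeff p (k + 1) = - (\<rho> + \<kappa> - 2 * d)"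
    "2 * coeff p k = (\<rho> + \<kappa> - 2 * d)\<^sup>2 - ((\<rho> - d)\<^sup>2 + (\<kappa> - d)\<^sup>2)"
    "\<And>j. j < k \<Longrightarrow> coeff p j \<le> 0"
    by (rule coeffs_nonpos_of_power_sums[OF Zcnj ZRe, where \<mu> = \<mu>, folded W_def, OF _ sizeW sumW1 sumW2 trace square_le])
      (assumption | rule that)+

  have "coeff p (k + 1) = - (c00 + c11 - 2 * d)" unfolding p(4) c(5) ..
  \<comment> \<open>Both sides equal \<open>(\<rho> - d) * (\<kappa> - d)\<close>, the value at
    \<open>d\<close> of the characteristic polynomial of the block.\<close>
  moreover have "coeff p k = (c00 - d) * (c11 - d) - c01 * c10"
  proof -
    have "coeff p k = \<rho> * \<kappa> - d * (\<rho> + \<kappa>) + d * d"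
      using p(5) by (simp add: power2_eq_square algebra_simps)
    then show ?thesis unfolding c(5)[symmetric] c(6)[symmetric] by (simp add: algebra_simps)
  qed
  ultimately obtain M where M: "M \<in> carrier_mat (k + 2) (k + 2)" "nonneg_mat M"
      "char_poly M = p \<circ>\<^sub>p [:- d, 1:]"
    and MC: "M $$ (k, k) = c00" "M $$ (k, k + 1) = c01" "M $$ (k + 1, k) = c10" "M $$ (k + 1, k + 1) = c11"
    using companion_extension[OF d(1) c(1-4) p(2,3) _ _ p(6)] by blast
  have "\<exists>N\<in>carrier_mat (k + 2 + l) (k + 2 + l). nonneg_mat N \<and>
      (\<exists>q. char_poly N = char_poly M * q \<and>
           char_poly A' = char_poly (mat 2 2 (\<lambda>(a, b). M $$ (k + a, k + b))) * q)"
    by (rule glue_along_invariant_plane[OF A'(1,2) M(1,2) x y, unfolded MC, OF _ _ Ax Ay])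
  then obtain N q where N: "N \<in> carrier_mat (k + 2 + l) (k + 2 + l)" "nonneg_mat N"
    and charN: "char_poly N = char_poly M * q"
    and charA: "char_poly A' = char_poly (mat 2 2 (\<lambda>(a, b). M $$ (k + a, k + b))) * q"
    by blast

  \<comment> \<open>The block has eigenvalues \<open>\<rho>\<close> and \<open>\<kappa>\<close>, so
    cancelling them from the spectrum of \<open>A\<close> leaves the remaining \<open>lam i\<close>
    as the roots of \<open>q\<close>.\<close>
  have "char_poly (mat 2 2 (\<lambda>(a, b). M $$ (k + a, k + b))) = [:- \<rho>, 1:] * [:- \<kappa>, 1:]"
    using c(5,6) MC by (simp add: char_poly_mat_2 algebra_simps)
  then have "map_poly complex_of_real (char_poly A) =
      [:- complex_of_real \<rho>, 1:] * ([:- complex_of_real \<kappa>, 1:] * map_poly complex_of_real q)"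
    unfolding A'(3)[symmetric] charA
    by (simp add: of_real_poly_hom.hom_mult map_poly_pCons mult.assoc del: mult_pCons_left mult_pCons_right)
  moreover have "proots (map_poly complex_of_real (char_poly A)) =
      mset (complex_of_real \<rho> # complex_of_real \<kappa> # ?ls)"
    using A(1) by (simp add: realises_def of_real_hom.char_poly_hom[OF Ac(1)])
  moreover have q0: "map_poly complex_of_real q \<noteq> 0"
  proof
    assume "map_poly complex_of_real q = 0"
    then have "char_poly N = 0" using charN by simp
    then show False using degree_monic_char_poly[OF N(1)] by simp
  qed
  ultimately have "add_mset (complex_of_real \<rho>) (add_mset (complex_of_real \<kappa>) (proots (map_poly complex_of_real q))) =
      mset (complex_of_real \<rho> # complex_of_real \<kappa> # ?ls)"
    by (simp add: proots_mult del: mult_pCons_left mult_pCons_right upt_Suc)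
  then have q: "proots (map_poly complex_of_real q) = mset ?ls" by simp

  \<comment> \<open>Composition with X - d moves every root back by \<open>d\<close>.\<close>
  have charM: "map_poly complex_of_real (char_poly M) = (\<Prod>z\<in>#mset (map mu [1..<Suc n]). [:- z, 1:])"
  proof -
    have "map_poly complex_of_real [:- d, 1:] = [:- complex_of_real d, 1:]"
      by (simp add: map_poly_pCons)
    then show ?thesis
      unfolding M(3) of_real_hom.map_poly_pcompose p(1) by (simp only: pcompose_prod_linear)
        (simp add: W multiset.map_comp o_def del: upt_Suc)
  qed
  have "map_poly complex_of_real (char_poly M) \<noteq> 0"
    using degree_monic_char_poly[OF M(1)] by auto
  then have "proots (char_poly (map_mat complex_of_real N)) = mset (map mu [1..<Suc n] @ ?ls)"
    unfolding of_real_hom.char_poly_hom[OF N(1)] charN of_real_poly_hom.hom_mult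
    by (subst proots_mult) (use q0 in \<open>simp_all add: q charM proots_prod_linear del: upt_Suc\<close>)
  then have "realises N (map mu [1..<Suc n] @ ?ls)"
    using N by (auto simp: realises_def nonneg_mat_def n m)
  then show ?thesis by (auto simp: realisable_def)
qed

end
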